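(* Let $m=(m_0,m_1,\dots)$ be a bounded sequence of integers with $m_k\ge 2$ for all $k$, let $G_m$ be the associated bounded Vilenkin group, and let $L_n f$ denote the $n$-th Nörlund logarithmic mean of the Vilenkin-Fourier series of a martingale $f$. Let $H_p(G_m)$ be the martingale Hardy space on $G_m$. a) Let $0<p<1$. Then the maximal operator $$\widetilde{L}_p^{*}f:=\sup_{n\in\mathbb{N}}\frac{|L_nf|}{(n+1)^{1/p-1}}$$ is bounded from $H_p(G_m)$ to $L_p(G_m)$; that is, there is a finite constant $c$ (independent of $f$) such that $\|\widetilde{L}_p^{*}f\|_p\le c\,\|f\|_{H_p}$ for all $f\in H_p(G_m)$. b) Let $0<p<1$ and let $\varphi:\mathbb{N}_+\to[1,\infty)$ be a non-decreasing function satisfying $$\limsup_{n\to\infty}\frac{n^{1/p-1}}{(\log n)\,\varphi(n)}=+\infty.$$ Then the maximal operator $$f\mapsto\sup_{n\in\mathbb{N}}\frac{|L_nf|}{\varphi(n+1)}$$ is not bounded from $H_p(G_m)$ to $L_p(G_m)$; that is, there is no finite constant $C$ such that $\left\|\sup_{n\in\mathbb{N}}\frac{|L_nf|}{\varphi(n+1)}\right\|_p\le C\|f\|_{H_p}$ for all $f\in H_p(G_m)$.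
   Context: $\mathbb{N}_+$ is the set of positive integers and $\mathbb{N}=\mathbb{N}_+\cup\{0\}$. **Vilenkin group.** Let $m=(m_0,m_1,\dots)$ be a sequence of integers $\ge 2$ with $\sup_k m_k<\infty$ (the bounded case). Let $Z_{m_k}=\{0,1,\dots,m_k-1\}$ be the additive group of integers modulo $m_k$ with the discrete topology, and let $G_m=\prod_{k\ge0}Z_{m_k}$ be the complete direct product with the product topology. Its elements are sequences $x=(x_0,x_1,\dots)$ with $x_k\in Z_{m_k}$. Let $\mu$ be the product of the uniform probability measures $\mu_k(\{j\})=1/m_k$ on $Z_{m_k}$; it is the Haar measure with $\mu(G_m)=1$. For $0<p<\infty$, $\|f\|_p=\left(\int_{G_m}|f|^p\,d\mu\right)^{1/p}$ is the norm (quasi-norm) of $L_p(G_m)$. Put $I_0(x)=G_m$ and $I_n(x)=\{y\in G_m: y_0=x_0,\dots,y_{n-1}=x_{n-1}\}$ for $n\ge1$. **Vilenkin system.** Put $M_0=1$, $M_{k+1}=m_kM_k$. Every $n\in\mathbb{N}$ is uniquely $n=\sum_{j\ge0}n_jM_j$ with $n_j\in Z_{m_j}$ and only finitely many $n_j\neq0$. The generalized Rademacher functions are $r_k(x)=\exp(2\pi i x_k/m_k)$ (here $i^2=-1$), and the Vilenkin functions are $\psi_n=\prod_{k\ge0}r_k^{n_k}$, $n\in\mathbb{N}$. **Martingales and Hardy spaces.** Let $\mathcal{F}_n$ be the $\sigma$-algebra generated by $\{I_n(x):x\in G_m\}$. Martingales $f=(f_n:n\in\mathbb{N})$ are taken with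 respect to $(\mathcal{F}_n)_{n\in\mathbb{N}}$ and $\mu$. The maximal function is $f^*=\sup_{n\in\mathbb{N}}|f_n|$. For $0<p<\infty$, $H_p(G_m)$ consists of all martingales $f$ with $\|f\|_{H_p}:=\|f^*\|_p<\infty$. **Fourier coefficients, partial sums, means.** For a martingale $f=(f_n)$, the Vilenkin-Fourier coefficients are $\widehat f(i)=\lim_{k\to\infty}\int_{G_m}f_k\overline{\psi_i}\,d\mu$, $i\in\mathbb{N}$. The partial sums are $S_0f=0$ and $S_nf=\sum_{k=0}^{n-1}\widehat f(k)\psi_k$ for $n\ge1$. The Nörlund logarithmic means are, for $n\ge1$, $$L_nf=\frac1{l_n}\sum_{k=0}^{n-1}\frac{S_kf}{n-k},\qquad l_n=\sum_{j=1}^{n}\frac1j .$$ The term $n=0$ in suprema over $n\in\mathbb{N}$ is interpreted as $L_0f=0$. *)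

theory Defs
  imports "HOL-Probability.Probability"
begin

section \<open>The Vilenkin group and its Haar measure\<close>

text \<open>A sequence \<open>m\<close> is given as a function on the naturals; the group is the set of sequences
  \<open>x\<close> with \<open>x k \<in> {..<m k}\<close>.  The measure is the product of the uniform probability
  measures on the factors.  Since the factors are finite and discrete, its product
  \<open>\<sigma>\<close>-algebra is the Borel \<open>\<sigma>\<close>-algebra of the product topology.\<close>

definition vil_measure :: "(nat \<Rightarrow> nat) \<Rightarrow> (nat \<Rightarrow> nat) measure" where
  "vil_measure m = (\<Pi>\<^sub>M k\<in>UNIV. uniform_count_measure {..<m k})"

definition vil_group :: "(nat \<Rightarrow> nat) \<Rightarrow> (nat \<Rightarrow> nat) set" where
  "vil_group m = {x. \<forall>k. x k < m k}"

lemma space_vil_measure: "space (vil_measure m) = vil_group m"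
  by (auto simp: vil_measure_def vil_group_def space_PiM space_uniform_count_measure PiE_def)

lemma prob_space_vil_measure:
  assumes "\<And>k. 2 \<le> m k"
  shows "prob_space (vil_measure m)"
proof -
  have "prob_space (uniform_count_measure {..<m k})" for k
    by (rule prob_space_uniform_count_measure) (use assms[of k] in \<open>auto simp: lessThan_empty_iff\<close>)
  then show ?thesis
    unfolding vil_measure_def by (intro prob_space_PiM)
qed

definition vil_cyl :: "(nat \<Rightarrow> nat) \<Rightarrow> nat \<Rightarrow> (nat \<Rightarrow> nat) \<Rightarrow> (nat \<Rightarrow> nat) set" where
  "vil_cyl m n x = {y \<in> vil_group m. \<forall>j<n. y j = x j}"

definition vil_filtration :: "(nat \<Rightarrow> nat) \<Rightarrow> nat \<Rightarrow> (nat \<Rightarrow> nat) measure" where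
  "vil_filtration m n = sigma (vil_group m) (vil_cyl m n ` vil_group m)"


section \<open>The Vilenkin system\<close>

definition vil_M :: "(nat \<Rightarrow> nat) \<Rightarrow> nat \<Rightarrow> nat" where
  "vil_M m k = (\<Prod>j<k. m j)"

text \<open>The digits of \<open>n\<close> in the mixed radix system with weights \<open>vil_M m j\<close>; the lemmas
  \<open>finite_vil_digit\<close>, \<open>vil_digit_expansion\<close> and \<open>vil_digit_unique\<close> below characterize them.\<close>

definition vil_digit :: "(nat \<Rightarrow> nat) \<Rightarrow> nat \<Rightarrow> nat \<Rightarrow> nat" where
  "vil_digit m n j = (n div vil_M m j) mod m j"

definition vil_rademacher :: "(nat \<Rightarrow> nat) \<Rightarrow> nat \<Rightarrow> (nat \<Rightarrow> nat) \<Rightarrow> complex" where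
  "vil_rademacher m k x = exp (2 * of_real pi * \<i> * of_nat (x k) / of_nat (m k))"

definition vil_psi :: "(nat \<Rightarrow> nat) \<Rightarrow> nat \<Rightarrow> (nat \<Rightarrow> nat) \<Rightarrow> complex" where
  "vil_psi m n x = (\<Prod>k | vil_digit m n k \<noteq> 0. vil_rademacher m k x ^ vil_digit m n k)"

lemma vil_M_gt:
  assumes "\<And>k. 2 \<le> m k"
  shows "n < vil_M m n"
proof (induction n)
  case 0
  then show ?case by (simp add: vil_M_def)
next
  case (Suc n)
  have "Suc n < vil_M m n * 2"
    using Suc by linarith
  also have "\<dots> \<le> vil_M m n * m n"
    using assms[of n] by simp
  finally show ?case by (simp add: vil_M_def)
qed

lemma vil_digit_eq_0:
  assumes "\<And>k. 2 \<le> m k" and "n \<le> j"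
  shows "vil_digit m n j = 0"
  using vil_M_gt[of m j] assms by (simp add: vil_digit_def)

lemma finite_vil_digit:
  assumes "\<And>k. 2 \<le> m k"
  shows "finite {j. vil_digit m n j \<noteq> 0}"
proof (rule finite_subset)
  show "{j. vil_digit m n j \<noteq> 0} \<subseteq> {..<n}"
    using vil_digit_eq_0[of m n, OF assms] linorder_not_less by blast
qed simp

lemma vil_digit_partial_sum:
  "(\<Sum>j<k. vil_digit m n j * vil_M m j) = n mod vil_M m k"
proof (induction k)
  case 0
  then show ?case by (simp add: vil_M_def)
next
  case (Suc k)
  have "n mod vil_M m (Suc k) = vil_M m k * (n div vil_M m k mod m k) + n mod vil_M m k"
    by (simp add: vil_M_def mod_mult2_eq)
  then show ?case
    using Suc by (simp add: vil_digit_def)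
qed

lemma vil_digit_expansion:
  assumes "\<And>k. 2 \<le> m k"
  shows "n = (\<Sum>j | vil_digit m n j \<noteq> 0. vil_digit m n j * vil_M m j)"
proof -
  have "(\<Sum>j | vil_digit m n j \<noteq> 0. vil_digit m n j * vil_M m j)
      = (\<Sum>j<n. vil_digit m n j * vil_M m j)"
  proof (rule sum.mono_neutral_left)
    show "{j. vil_digit m n j \<noteq> 0} \<subseteq> {..<n}"
      using vil_digit_eq_0[of m n, OF assms] linorder_not_less by blast
  qed auto
  also have "\<dots> = n"
    using vil_M_gt[of m n, OF assms] by (simp add: vil_digit_partial_sum)
  finally show ?thesis by simp
qed

lemma vil_digit_unique:
  assumes m: "\<And>k. 2 \<le> m k" and d: "\<And>j. d j < m j" and fin: "finite {j. d j \<noteq> 0}"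
    and n: "n = (\<Sum>j | d j \<noteq> 0. d j * vil_M m j)"
  shows "d = vil_digit m n"
proof
  fix j
  have lt: "(\<Sum>i<k. d i * vil_M m i) < vil_M m k" for k
  proof (induction k)
    case 0
    then show ?case by (simp add: vil_M_def)
  next
    case (Suc k)
    have "(\<Sum>i<Suc k. d i * vil_M m i) < (d k + 1) * vil_M m k"
      using Suc by simp
    also have "\<dots> \<le> m k * vil_M m k"
      using d[of k] by (intro mult_right_mono) auto
    finally show ?case by (simp add: vil_M_def mult.commute)
  qed
  obtain N where N: "{j. d j \<noteq> 0} \<subseteq> {..<N}"
    using fin finite_nat_iff_bounded by blast
  define K where "K = max N (Suc j)"
  have "n = (\<Sum>i<K. d i * vil_M m i)"
    unfolding n by (rule sum.mono_neutral_left) (use N in \<open>auto simp: K_def\<close>)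
  also have "{..<K} = {..<Suc j} \<union> {Suc j..<K}"
    by (auto simp: K_def)
  also have "(\<Sum>i\<in>\<dots>. d i * vil_M m i)
      = (\<Sum>i<Suc j. d i * vil_M m i) + (\<Sum>i=Suc j..<K. d i * vil_M m i)"
    by (rule sum.union_disjoint) auto
  finally have eq: "n = (\<Sum>i<Suc j. d i * vil_M m i) + (\<Sum>i=Suc j..<K. d i * vil_M m i)" .
  have "vil_M m (Suc j) dvd d i * vil_M m i" if "Suc j \<le> i" for i
    unfolding vil_M_def using that by (intro dvd_mult prod_dvd_prod_subset) auto
  then have "vil_M m (Suc j) dvd (\<Sum>i=Suc j..<K. d i * vil_M m i)"
    by (intro dvd_sum) auto
  then have "n mod vil_M m (Suc j) = (\<Sum>i<Suc j. d i * vil_M m i)"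
    using eq lt[of "Suc j"] by (metis dvd_def mod_less mod_mult_self2)
  moreover have "vil_digit m n j = n mod vil_M m (Suc j) div vil_M m j"
  proof -
    have "vil_M m (Suc j) = vil_M m j * m j"
      by (simp add: vil_M_def)
    moreover have "vil_M m j \<noteq> 0"
      using vil_M_gt[of m j, OF m] by simp
    ultimately show ?thesis
      by (simp add: vil_digit_def mod_mult2_eq)
  qed
  ultimately show "d j = vil_digit m n j"
    using lt[of j] by simp
qed


section \<open>Martingales and Hardy spaces\<close>

text \<open>Complex-valued martingales.  The last clause is the defining property of
  \<open>E(f k | F n) = f n\<close> (the library's \<open>real_cond_exp\<close> covers only real-valued functions).\<close>

definition vil_martingale :: "(nat \<Rightarrow> nat) \<Rightarrow> (nat \<Rightarrow> (nat \<Rightarrow> nat) \<Rightarrow> complex) \<Rightarrow> bool" where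
  "vil_martingale m f \<longleftrightarrow>
     (\<forall>n. f n \<in> borel_measurable (vil_filtration m n)) \<and>
     (\<forall>n. integrable (vil_measure m) (f n)) \<and>
     (\<forall>n k. n \<le> k \<longrightarrow> (\<forall>A\<in>sets (vil_filtration m n).
        (LINT x:A|vil_measure m. f k x) = (LINT x:A|vil_measure m. f n x)))"

text \<open>Suprema may be infinite, so the \<open>L\<^sub>p\<close> quasi-norm is defined for \<open>[0,\<infinity>]\<close>-valued functions;
  a complex function \<open>f\<close> enters through \<open>ennreal (norm (f x))\<close>.  The power is only used with a
  positive exponent.\<close>

definition epowr :: "ennreal \<Rightarrow> real \<Rightarrow> ennreal" where
  "epowr a p = (if a = \<infinity> then \<infinity> else ennreal (enn2real a powr p))"

definition vil_Lp_norm :: "(nat \<Rightarrow> nat) \<Rightarrow> real \<Rightarrow> ((nat \<Rightarrow> nat) \<Rightarrow> ennreal) \<Rightarrow> ennreal" where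
  "vil_Lp_norm m p g = epowr (\<integral>\<^sup>+ x. epowr (g x) p \<partial>vil_measure m) (1 / p)"

definition maximal_fun :: "(nat \<Rightarrow> (nat \<Rightarrow> nat) \<Rightarrow> complex) \<Rightarrow> (nat \<Rightarrow> nat) \<Rightarrow> ennreal" where
  "maximal_fun f x = (SUP n. ennreal (norm (f n x)))"

definition vil_Hp_norm ::
  "(nat \<Rightarrow> nat) \<Rightarrow> real \<Rightarrow> (nat \<Rightarrow> (nat \<Rightarrow> nat) \<Rightarrow> complex) \<Rightarrow> ennreal" where
  "vil_Hp_norm m p f = vil_Lp_norm m p (maximal_fun f)"

definition vil_Hp :: "(nat \<Rightarrow> nat) \<Rightarrow> real \<Rightarrow> (nat \<Rightarrow> (nat \<Rightarrow> nat) \<Rightarrow> complex) set" where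
  "vil_Hp m p = {f. vil_martingale m f \<and> vil_Hp_norm m p f < \<infinity>}"

definition bounded_Hp_Lp ::
  "(nat \<Rightarrow> nat) \<Rightarrow> real \<Rightarrow>
    ((nat \<Rightarrow> (nat \<Rightarrow> nat) \<Rightarrow> complex) \<Rightarrow> (nat \<Rightarrow> nat) \<Rightarrow> ennreal) \<Rightarrow> bool" where
  "bounded_Hp_Lp m p T \<longleftrightarrow>
     (\<exists>c::real. \<forall>f\<in>vil_Hp m p. vil_Lp_norm m p (T f) \<le> ennreal c * vil_Hp_norm m p f)"


section \<open>Partial sums and logarithmic means\<close>

definition vil_coeff ::
  "(nat \<Rightarrow> nat) \<Rightarrow> (nat \<Rightarrow> (nat \<Rightarrow> nat) \<Rightarrow> complex) \<Rightarrow> nat \<Rightarrow> complex" where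
  "vil_coeff m f i = lim (\<lambda>k. LINT x|vil_measure m. f k x * cnj (vil_psi m i x))"

definition vil_partial_sum ::
  "(nat \<Rightarrow> nat) \<Rightarrow> (nat \<Rightarrow> (nat \<Rightarrow> nat) \<Rightarrow> complex) \<Rightarrow> nat \<Rightarrow> (nat \<Rightarrow> nat) \<Rightarrow> complex" where
  "vil_partial_sum m f n x = (\<Sum>k<n. vil_coeff m f k * vil_psi m k x)"

text \<open>\<open>harm n = (\<Sum>j=1..n. 1/j)\<close>.  For \<open>n = 0\<close> the sum is empty and the value is \<open>0\<close>.\<close>

definition vil_log_mean ::
  "(nat \<Rightarrow> nat) \<Rightarrow> (nat \<Rightarrow> (nat \<Rightarrow> nat) \<Rightarrow> complex) \<Rightarrow> nat \<Rightarrow> (nat \<Rightarrow> nat) \<Rightarrow> complex" where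
  "vil_log_mean m f n x = (\<Sum>k<n. vil_partial_sum m f k x / of_nat (n - k)) / harm n"

definition log_mean_maximal ::
  "(nat \<Rightarrow> nat) \<Rightarrow> (nat \<Rightarrow> real) \<Rightarrow>
    (nat \<Rightarrow> (nat \<Rightarrow> nat) \<Rightarrow> complex) \<Rightarrow> (nat \<Rightarrow> nat) \<Rightarrow> ennreal" where
  "log_mean_maximal m w f x = (SUP n. ennreal (norm (vil_log_mean m f n x) / w (n + 1)))"

end

theory Submission
  imports Defs
begin

text \<open>
  Upper bound.  Let \<open>n \<le> M\<^sub>K\<close> with \<open>M\<^sub>K\<close> comparable to \<open>n\<close>, and let \<open>a = 1/p - 1\<close>.  The sum of the
  characters over an aligned block of length \<open>M\<^sub>j\<close> vanishes off \<open>I\<^sub>j\<close>, so the Dirichlet kernel \<open>D\<^sub>n\<close>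
  is bounded by \<open>B\<close> times the sum over \<open>j \<le> K\<close> of \<open>M\<^sub>j\<close> times the indicator of \<open>I\<^sub>j\<close>.  Since \<open>f\<^sub>K\<close> is
  constant on cylinders of measure \<open>1 / M\<^sub>K\<close> and \<open>p < 1\<close>, the integral of \<open>\<bar>f\<^sub>K\<bar>\<close> over \<open>I\<^sub>j(x)\<close> is at
  most \<open>M\<^sub>K powr a * F\<^sub>j(x) powr (1/p)\<close>, where \<open>F\<^sub>j(x)\<close> is the integral of \<open>f* powr p\<close> over \<open>I\<^sub>j(x)\<close>.
  Hence \<open>(\<bar>S\<^sub>n f(x)\<bar> / n powr a) powr p \<le> B * (\<Sum>j. M\<^sub>j powr p * F\<^sub>j(x))\<close> uniformly in \<open>n\<close>, and by
  Tonelli the right-hand side integrates to \<open>B * (\<Sum>j. M\<^sub>j powr (p - 1))\<close> times the integral of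
  \<open>f* powr p\<close>.  No atomic decomposition is needed.  The means \<open>L\<^sub>n f\<close> are averages of the \<open>S\<^sub>k f\<close>
  with \<open>k < n\<close>.

  Lower bound.  With \<open>N = M\<^sub>k\<close> and \<open>N' = M\<^sub>k\<^sub>+\<^sub>1\<close>, take the martingale with limit \<open>D\<^bsub>N'\<^esub> - D\<^bsub>N\<^esub>\<close>.  Its
  first nonzero partial sum is the one of order \<open>N + 1\<close>, which is \<open>\<psi>\<^bsub>N\<^esub>\<close>; so its logarithmic mean
  of order \<open>N + 2\<close> has modulus \<open>1 / harm (N + 2)\<close> everywhere, while its Hardy norm is at most
  \<open>B * N powr (1 - 1/p)\<close>.
\<close>

section \<open>Preliminaries\<close>

lemma epowr_ennreal: "0 \<le> a \<Longrightarrow> epowr (ennreal a) p = ennreal (a powr p)"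
  by (simp add: epowr_def)

lemma epowr_mono:
  assumes "a \<le> b" "0 \<le> p"
  shows "epowr a p \<le> epowr b p"
proof (cases b)
  case (real r)
  with assms obtain s where "a = ennreal s" "0 \<le> s"
    by (metis ennreal_cases ennreal_less_top linorder_not_less)
  with real assms show ?thesis
    by (auto simp: epowr_ennreal intro!: ennreal_leI powr_mono2)
qed (simp add: epowr_def)

lemma epowr_mult_const:
  assumes "0 < c" "0 < q"
  shows "epowr (ennreal c * a) q = ennreal (c powr q) * epowr a q"
proof (cases a)
  case (real s)
  with assms show ?thesis
    by (simp add: epowr_ennreal powr_mult flip: ennreal_mult)
next
  case top
  with assms show ?thesis
    by (simp add: epowr_def ennreal_mult_top)
qed

lemma epowr_measurable [measurable]: "(\<lambda>a. epowr a p) \<in> borel_measurable borel"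
  unfolding epowr_def by measurable

text \<open>Each \<open>z j\<close> is at most the total \<open>S\<close>, so
  \<open>z j powr q \<le> z j * S powr (q - 1)\<close>; summing over \<open>j\<close> gives
  \<open>S powr q\<close>.\<close>

lemma sum_powr_le_powr_sum:
  assumes "finite A" "\<And>j. j \<in> A \<Longrightarrow> 0 \<le> z j" "1 \<le> (q::real)"
  shows "(\<Sum>j\<in>A. z j powr q) \<le> (\<Sum>j\<in>A. z j) powr q"
proof -
  define S where "S = (\<Sum>j\<in>A. z j)"
  have S: "0 \<le> z j" "z j \<le> S" "0 \<le> S" if "j \<in> A" for j
    using assms that unfolding S_def by (auto intro!: member_le_sum sum_nonneg)
  have split: "a powr q = a * a powr (q - 1)" if "0 \<le> a" for a :: real
    using that by (cases "a = 0") (auto simp: powr_diff)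
  have "(\<Sum>j\<in>A. z j powr q) \<le> (\<Sum>j\<in>A. z j * S powr (q - 1))"
    using S assms(3) by (intro sum_mono) (auto simp: split intro!: mult_left_mono powr_mono2)
  also have "\<dots> = S powr q"
    unfolding sum_distrib_right[symmetric] S_def[symmetric]
    using assms by (subst split[of S]) (auto simp: S_def sum_nonneg)
  finally show ?thesis unfolding S_def .
qed

text \<open>The difference \<open>harm n - ln n\<close> is decreasing with value 1 at
  \<open>n = 1\<close>, and this 1 is absorbed by \<open>ln n\<close>, which is at least 1 from
  \<open>n = 3\<close> on.\<close>

lemma harm_le_two_ln:
  assumes "3 \<le> n"
  shows "harm n \<le> 2 * ln (real n)"
proof -
  have "harm n - ln (real n) \<le> harm 1 - ln (real 1)"
    using assms by (intro euler_mascheroni_sequence_decreasing) auto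
  moreover have "1 \<le> ln (real n)"
    using exp_le assms by (subst ln_ge_iff) auto
  ultimately show ?thesis
    by (simp add: harm_def)
qed


section \<open>Cylinders, characters and kernels\<close>

locale vilenkin =
  fixes m :: "nat \<Rightarrow> nat"
  assumes two_le: "2 \<le> m k"
begin

abbreviation "\<mu> \<equiv> vil_measure m"
abbreviation "M \<equiv> vil_M m"
abbreviation "cyl \<equiv> vil_cyl m"
abbreviation "G \<equiv> vil_group m"
abbreviation "\<psi> \<equiv> vil_psi m"
abbreviation "r \<equiv> vil_rademacher m"

sublocale prob_space \<mu>
  by (rule prob_space_vil_measure) (rule two_le)

lemma m_pos [simp]: "0 < m k"
  using two_le[of k] by linarith

lemma M_pos [simp]: "0 < M k"
  by (simp add: vil_M_def prod_pos)

lemma M_neq_0 [simp]: "M k \<noteq> 0"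
  using M_pos[of k] by linarith

lemma M_0 [simp]: "M 0 = 1"
  by (simp add: vil_M_def)

lemma M_Suc: "M (Suc k) = m k * M k"
  by (simp add: vil_M_def mult.commute)

lemma two_power_le_M: "2 ^ k \<le> M k"
  by (induction k) (auto simp: M_Suc intro!: mult_mono two_le)

lemma M_dvd: "i \<le> j \<Longrightarrow> M i dvd M j"
  unfolding vil_M_def by (intro prod_dvd_prod_subset) auto

lemma M_mono: "i \<le> j \<Longrightarrow> M i \<le> M j"
  by (rule dvd_imp_le[OF M_dvd M_pos])

lemma less_M: "n < M n"
  by (rule vil_M_gt) (rule two_le)

lemma zero_in_group [simp]: "(\<lambda>_. 0) \<in> G"
  by (simp add: vil_group_def)

section \<open>Cylinders and the filtration they generate\<close>

lemma cyl_subset_group: "cyl n x \<subseteq> G"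
  by (auto simp: vil_cyl_def)

lemma mem_cyl_iff: "y \<in> cyl n x \<longleftrightarrow> y \<in> G \<and> (\<forall>j<n. y j = x j)"
  by (simp add: vil_cyl_def)

lemma cyl_antimono: "i \<le> j \<Longrightarrow> cyl j x \<subseteq> cyl i x"
  by (auto simp: vil_cyl_def)

lemma cyl_eq: "y \<in> cyl n x \<Longrightarrow> k \<le> n \<Longrightarrow> cyl k y = cyl k x"
  by (auto simp: vil_cyl_def)

text \<open>In this form the measure of a cylinder follows from the product formula for boxes, as
  used in \<open>measure_cyl\<close>.\<close>

lemma cyl_eq_emb:
  assumes "x \<in> G"
  shows "cyl n x = prod_emb UNIV (\<lambda>k. uniform_count_measure {..<m k}) {..<n} (\<Pi>\<^sub>E j\<in>{..<n}. {x j})"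
  by (auto simp: mem_cyl_iff prod_emb_def PiE_iff vil_group_def space_uniform_count_measure
      extensional_def)

lemma emeasure_uniform_singleton:
  "j < m k \<Longrightarrow> emeasure (uniform_count_measure {..<m k}) {j} = ennreal (1 / m k)"
  by (subst emeasure_uniform_count_measure) auto

lemma measurable_coordinate [measurable]: "(\<lambda>y. y j) \<in> \<mu> \<rightarrow>\<^sub>M count_space UNIV"
proof -
  have "(\<lambda>y. y j) \<in> \<mu> \<rightarrow>\<^sub>M uniform_count_measure {..<m j}"
    unfolding vil_measure_def by (rule measurable_component_singleton) simp
  moreover have "id \<in> uniform_count_measure {..<m j} \<rightarrow>\<^sub>M count_space UNIV"
    by (simp add: measurable_def space_uniform_count_measure sets_uniform_count_measure)
  ultimately have "id \<circ> (\<lambda>y. y j) \<in> \<mu> \<rightarrow>\<^sub>M count_space UNIV"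
    by (rule measurable_comp)
  then show ?thesis
    by (simp add: comp_def)
qed

lemma cyl_sets [measurable]: "cyl n x \<in> sets \<mu>"
proof -
  have "cyl n x = {y\<in>space \<mu>. \<forall>j<n. y j = x j}"
    by (auto simp: mem_cyl_iff space_vil_measure)
  also have "\<dots> \<in> sets \<mu>"
    by measurable
  finally show ?thesis .
qed

lemma measure_cyl:
  assumes "x \<in> G"
  shows "measure \<mu> (cyl n x) = 1 / M n"
proof -
  have "emeasure \<mu> (cyl n x) = (\<Prod>j\<in>{..<n}. emeasure (uniform_count_measure {..<m j}) {x j})"
    unfolding cyl_eq_emb[OF assms] vil_measure_def using assms
    by (intro emeasure_PiM_emb prob_space_uniform_count_measure)
       (auto simp: sets_uniform_count_measure vil_group_def lessThan_empty_iff not_less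
          dest: spec[of _ 0])
  also have "\<dots> = (\<Prod>j<n. ennreal (1 / m j))"
    using assms by (intro prod.cong) (auto simp: emeasure_uniform_singleton vil_group_def)
  also have "\<dots> = ennreal (1 / M n)"
    by (simp add: prod_ennreal vil_M_def prod_dividef)
  finally show ?thesis
    by (simp add: measure_def)
qed

lemma emeasure_cyl: "x \<in> G \<Longrightarrow> emeasure \<mu> (cyl n x) = ennreal (1 / M n)"
  by (simp add: emeasure_eq_measure measure_cyl)

lemma filtration_space [simp]: "space (vil_filtration m n) = G"
  by (auto simp: vil_filtration_def space_measure_of_conv)

lemma filtration_sets: "sets (vil_filtration m n) = sigma_sets G (cyl n ` G)"
  unfolding vil_filtration_def using cyl_subset_group by (intro sets_measure_of) auto

lemma cyl_in_filtration: "x \<in> G \<Longrightarrow> cyl n x \<in> sets (vil_filtration m n)"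
  unfolding filtration_sets by auto

lemma filtration_sets_subset: "sets (vil_filtration m n) \<subseteq> sets \<mu>"
  unfolding filtration_sets by (metis (no_types, lifting) cyl_sets image_subsetI sets.sigma_sets_subset
      space_vil_measure)

lemma filtration_measurable_imp: "g \<in> borel_measurable (vil_filtration m n) \<Longrightarrow> g \<in> borel_measurable \<mu>"
  using filtration_sets_subset[of n]
  by (auto simp: measurable_def space_vil_measure)

text \<open>Unions of cylinders of rank \<open>n\<close> include the generators and are closed under
  complements and countable unions.\<close>

lemma filtration_set_saturated:
  assumes "A \<in> sets (vil_filtration m n)" "x \<in> G" "y \<in> cyl n x"
  shows "x \<in> A \<longleftrightarrow> y \<in> A"
  using assms(1) unfolding filtration_sets
proof (induction rule: sigma_sets.induct)
  case (Basic a)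
  then show ?case using assms(2,3) by (auto simp: mem_cyl_iff)
next
  case (Compl a)
  then show ?case using assms(2,3) cyl_subset_group by auto
qed auto

lemma filtration_measurable_const:
  fixes g :: "(nat \<Rightarrow> nat) \<Rightarrow> complex"
  assumes "g \<in> borel_measurable (vil_filtration m n)" "x \<in> G" "y \<in> cyl n x"
  shows "g y = g x"
proof -
  \<comment> \<open>The level set through \<open>x\<close> is measurable, hence contains the whole
    cylinder around \<open>x\<close>.\<close>
  have "g -` {g x} \<inter> space (vil_filtration m n) \<in> sets (vil_filtration m n)"
    by (rule measurable_sets[OF assms(1)]) simp
  from filtration_set_saturated[OF this assms(2,3)] assms(2,3) show ?thesis
    by auto
qed

section \<open>Vilenkin functions and mixed radix digits\<close>

lemma psi_eq_prod:
  assumes "n < M N"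
  shows "\<psi> n x = (\<Prod>k<N. r k x ^ vil_digit m n k)"
proof -
  have "vil_digit m n k = 0" if "N \<le> k" for k
    using M_mono[OF that] assms by (simp add: vil_digit_def)
  then have "{k. vil_digit m n k \<noteq> 0} \<subseteq> {..<N}"
    by (metis (mono_tags) lessThan_iff linorder_not_less mem_Collect_eq subsetI)
  then show ?thesis
    unfolding vil_psi_def by (intro prod.mono_neutral_left) auto
qed

lemma norm_rademacher [simp]: "cmod (r k x) = 1"
proof -
  have "2 * of_real pi * \<i> * of_nat (x k) / of_nat (m k) = \<i> * of_real (2 * pi * x k / m k)"
    by simp
  then show ?thesis
    unfolding vil_rademacher_def by (metis norm_exp_i_times)
qed

lemma norm_psi [simp]: "cmod (\<psi> n x) = 1"
  by (simp add: psi_eq_prod[OF less_M] prod_norm[symmetric] norm_power)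

lemma psi_cong: "n < M N \<Longrightarrow> (\<And>j. j < N \<Longrightarrow> y j = x j) \<Longrightarrow> \<psi> n y = \<psi> n x"
  by (simp add: psi_eq_prod vil_rademacher_def)

lemma psi_measurable [measurable]: "\<psi> n \<in> borel_measurable \<mu>"
proof -
  have "r k \<in> borel_measurable \<mu>" for k
    unfolding vil_rademacher_def by measurable
  then show ?thesis
    unfolding psi_eq_prod[OF less_M] by measurable
qed

lemma digit_add_low:
  assumes "l < M s" "j < s"
  shows "vil_digit m (q * M s + l) j = vil_digit m l j"
proof -
  obtain u where u: "M s = M (Suc j) * u"
    using M_dvd[of "Suc j" s] assms by (auto elim: dvdE)
  have "q * M s + l = l + M j * (m j * (q * u))"
    using u by (simp add: M_Suc algebra_simps)
  then have "(q * M s + l) div M j = l div M j + m j * (q * u)"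
    using M_pos[of j] by (simp only: div_mult_self2 neq0_conv)
  then show ?thesis
    by (simp add: vil_digit_def)
qed

lemma digit_add_high:
  assumes "l < M s" "s \<le> j"
  shows "vil_digit m (q * M s + l) j = vil_digit m (q * M s) j"
proof -
  obtain u where u: "M j = M s * u"
    using M_dvd[OF assms(2)] by (auto elim: dvdE)
  have "(q * M s + l) div M j = (q * M s) div M j"
    using assms by (simp add: u div_mult2_eq)
  then show ?thesis
    by (simp add: vil_digit_def)
qed

lemma digit_mult_low: "j < s \<Longrightarrow> vil_digit m (q * M s) j = 0"
  using digit_add_low[of 0 s j q] by (simp add: vil_digit_def)

lemma digit_high_zero: "l < M s \<Longrightarrow> s \<le> j \<Longrightarrow> vil_digit m l j = 0"
  using digit_add_high[of l s j 0] by (simp add: vil_digit_def)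

text \<open>There are no carries: \<open>q * M s\<close> has its nonzero digits at positions from
  \<open>s\<close> on and \<open>l\<close> below \<open>s\<close>, so the exponents add position by
  position.\<close>

lemma psi_add:
  assumes "l < M s"
  shows "\<psi> (q * M s + l) x = \<psi> (q * M s) x * \<psi> l x"
proof -
  define N where "N = max s (q * M s + l)"
  have N: "q * M s + l < M N"
    by (metis N_def less_M max.cobounded2 order.strict_trans1)
  have "r k x ^ vil_digit m (q * M s + l) k
      = r k x ^ vil_digit m (q * M s) k * r k x ^ vil_digit m l k" for k
    using assms by (cases "k < s")
      (simp_all add: digit_add_low digit_add_high digit_mult_low digit_high_zero)
  moreover have "q * M s < M N" "l < M N"
    using N by simp_all
  ultimately show ?thesis
    using N by (simp add: psi_eq_prod[where N = N] prod.distrib)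
qed

lemma psi_power:
  assumes "d < m s"
  shows "\<psi> (d * M s) x = r s x ^ d"
proof -
  have "vil_digit m (d * M s) s = d"
    using assms by (simp add: vil_digit_def)
  moreover have "d * M s < M (Suc s)"
    using assms by (simp add: M_Suc)
  ultimately show ?thesis
    by (simp add: psi_eq_prod digit_mult_low)
qed

text \<open>This is the Dirichlet kernel \<open>D_n(x - t)\<close>, written in two variables so that
  no group subtraction is involved.\<close>

definition kernel :: "nat \<Rightarrow> (nat \<Rightarrow> nat) \<Rightarrow> (nat \<Rightarrow> nat) \<Rightarrow> complex" where
  "kernel n x t = (\<Sum>i<n. \<psi> i x * cnj (\<psi> i t))"

lemma rademacher_root: "r k x * cnj (r k t) = cis (2 * pi * (real (x k) - real (t k)) / m k)"
proof -
  have "r k x = cis (2 * pi * x k / m k)" for x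
    unfolding vil_rademacher_def cis_conv_exp by (rule arg_cong[of _ _ exp]) simp
  then show ?thesis
    by (simp add: cis_mult cis_cnj diff_divide_distrib right_diff_distrib)
qed

text \<open>The base of the powers is an \<open>m k\<close>-th root of unity. It differs from 1
  because \<open>x k\<close> and \<open>t k\<close> are distinct residues, so the full geometric sum
  vanishes.\<close>

lemma sum_rademacher_eq_0:
  assumes "x \<in> G" "t \<in> G" "x k \<noteq> t k"
  shows "(\<Sum>d<m k. (r k x * cnj (r k t)) ^ d) = 0"
proof -
  define w where "w = r k x * cnj (r k t)"
  have lt: "x k < m k" "t k < m k"
    using assms by (auto simp: vil_group_def)
  have "w \<noteq> 1"
  proof
    assume "w = 1"
    then have "cos (2 * pi * (real (x k) - real (t k)) / m k) = 1"
      unfolding w_def rademacher_root by (simp add: complex_eq_iff)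
    then obtain z :: int where "2 * pi * (real (x k) - real (t k)) / m k = of_int z * 2 * pi"
      unfolding cos_one_2pi_int by blast
    then have "(2 * pi) * (real (x k) - real (t k)) = (2 * pi) * (of_int z * m k)"
      by (simp add: field_simps)
    then have "real (x k) - real (t k) = of_int z * m k"
      unfolding mult_cancel_left by simp
    then have "real_of_int (int (x k)) = of_int (int (t k) + z * int (m k))"
      by simp
    then have "int (x k) = int (t k) + z * int (m k)"
      by (simp only: of_int_eq_iff)
    then have "int (x k) mod int (m k) = int (t k) mod int (m k)"
      by simp
    with lt assms(3) show False by simp
  qed
  moreover have "w ^ m k = 1"
  proof -
    have "w ^ m k = cis (m k * (2 * pi * (real (x k) - real (t k)) / m k))"
      unfolding w_def rademacher_root by (rule Complex.DeMoivre)
    also have "\<dots> = cis (2 * pi * of_int (int (x k) - int (t k)))"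
      by (rule arg_cong[of _ _ cis]) (simp add: less_imp_neq[OF m_pos, symmetric])
    also have "\<dots> = 1"
      by (rule cis_multiple_2pi) simp
    finally show ?thesis .
  qed
  ultimately show ?thesis
    unfolding w_def[symmetric] using geometric_sum[of w "m k"] by simp
qed

lemma kernel_add:
  assumes "l \<le> M s"
  shows "kernel (q * M s + l) x t
    = kernel (q * M s) x t + \<psi> (q * M s) x * cnj (\<psi> (q * M s) t) * kernel l x t"
  using assms
proof (induction l)
  case (Suc l)
  then have "l < M s" by simp
  then have "\<psi> (q * M s + l) y = \<psi> (q * M s) y * \<psi> l y" for y
    by (rule psi_add)
  with Suc show ?case
    by (simp add: kernel_def distrib_left)
qed (simp add: kernel_def)

text \<open>Passing from \<open>s\<close> to \<open>s + 1\<close> joins \<open>m s\<close> blocks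
  and multiplies the kernel by a geometric sum, which is \<open>m s\<close> if the coordinates at
  \<open>s\<close> agree and 0 otherwise.\<close>

lemma kernel_M:
  assumes "x \<in> G" "t \<in> G"
  shows "kernel (M s) x t = (if t \<in> cyl s x then M s else 0)"
proof (induction s)
  case 0
  then show ?case using assms by (auto simp: kernel_def mem_cyl_iff psi_eq_prod[of 0 0])
next
  case (Suc s)
  have "kernel (d * M s) x t = (\<Sum>i<d. (r s x * cnj (r s t)) ^ i) * kernel (M s) x t" if "d \<le> m s" for d
    using that
  proof (induction d)
    case (Suc d)
    then show ?case
      using kernel_add[of "M s" s d x t]
      by (simp add: psi_power algebra_simps power_mult_distrib)
  qed (simp add: kernel_def)
  from this[of "m s"] have eq: "kernel (M (Suc s)) x t = (\<Sum>i<m s. (r s x * cnj (r s t)) ^ i) * kernel (M s) x t"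
    by (simp add: M_Suc)
  show ?case
  proof (cases "x s = t s")
    case True
    then have "r s x * cnj (r s t) = 1"
      by (simp add: rademacher_root)
    then show ?thesis
      unfolding eq Suc using True by (auto simp: M_Suc mem_cyl_iff less_Suc_eq)
  next
    case False
    then show ?thesis
      unfolding eq sum_rademacher_eq_0[OF assms False]
      by (auto simp: mem_cyl_iff)
  qed
qed

lemma norm_kernel_le: "cmod (kernel n x t) \<le> n"
proof -
  have "cmod (kernel n x t) \<le> (\<Sum>i<n. cmod (\<psi> i x * cnj (\<psi> i t)))"
    unfolding kernel_def by (rule norm_sum)
  then show ?thesis by (simp add: norm_mult)
qed

text \<open>By \<open>kernel_add\<close>, every aligned block of length \<open>M s\<close>
  contributes a multiple of \<open>kernel (M s) x t\<close>.\<close>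

lemma kernel_mult_eq_0:
  assumes "kernel (M s) x t = 0"
  shows "kernel (q * M s) x t = 0"
proof (induction q)
  case (Suc q)
  then show ?case
    using kernel_add[of "M s" s q x t] assms by (simp add: algebra_simps)
qed (simp add: kernel_def)

text \<open>The complete blocks of length \<open>M s\<close> cancel; only the remainder, of length
  \<open>n mod M s\<close>, survives up to a unimodular factor.\<close>

lemma norm_kernel_le_M:
  assumes "x \<in> G" "t \<in> G" "t \<notin> cyl s x"
  shows "cmod (kernel n x t) \<le> M s"
proof -
  have "kernel (M s) x t = 0"
    using assms by (simp add: kernel_M)
  then have "kernel (n div M s * M s) x t = 0"
    by (rule kernel_mult_eq_0)
  then have "cmod (kernel (n div M s * M s + n mod M s) x t) = cmod (kernel (n mod M s) x t)"
    by (subst kernel_add) (simp_all add: norm_mult)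
  then have "cmod (kernel n x t) = cmod (kernel (n mod M s) x t)"
    by (simp only: div_mult_mod_eq)
  also have "\<dots> \<le> n mod M s"
    by (rule norm_kernel_le)
  also have "\<dots> \<le> M s"
    by simp
  finally show ?thesis by simp
qed

end


section \<open>Partial sums of martingales\<close>

context vilenkin
begin

section \<open>Integrals against functions constant on cylinders\<close>

lemma finite_cyls: "finite (cyl n ` G)"
proof (induction n)
  case 0
  have "cyl 0 ` G \<subseteq> {G}"
    by (auto simp: mem_cyl_iff)
  then show ?case
    by (rule finite_subset) simp
next
  case (Suc n)
  have "cyl (Suc n) ` G \<subseteq> (\<lambda>(A, d). {y \<in> A. y n = d}) ` (cyl n ` G \<times> {..<m n})"
  proof
    fix A
    assume "A \<in> cyl (Suc n) ` G"
    then obtain x where x: "x \<in> G" "A = cyl (Suc n) x"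
      by auto
    have "A = (\<lambda>(A, d). {y \<in> A. y n = d}) (cyl n x, x n)"
      unfolding x by (auto simp: mem_cyl_iff less_Suc_eq)
    then show "A \<in> (\<lambda>(A, d). {y \<in> A. y n = d}) ` (cyl n ` G \<times> {..<m n})"
      using x(1) by (intro image_eqI[of _ _ "(cyl n x, x n)"]) (auto simp: vil_group_def)
  qed
  then show ?case
    by (rule finite_subset) (use Suc in auto)
qed

text \<open>The integral depends on \<open>f\<close> only through its integrals over cylinders of
  rank \<open>n\<close>, which are what the martingale property controls. \<open>SOME\<close> picks
  a representative of each cylinder.\<close>

lemma integral_mult_cyl_const:
  fixes f g :: "(nat \<Rightarrow> nat) \<Rightarrow> complex"
  assumes f: "integrable \<mu> f"
    and g: "\<And>x y. x \<in> G \<Longrightarrow> y \<in> cyl n x \<Longrightarrow> g y = g x"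
  shows "(\<integral>x. f x * g x \<partial>\<mu>)
    = (\<Sum>A\<in>cyl n ` G. g (SOME x. x \<in> A) * (LINT x:A|\<mu>. f x))"
proof -
  have "f x * g x = (\<Sum>A\<in>cyl n ` G. g (SOME x. x \<in> A) * (indicator A x *\<^sub>R f x))" if "x \<in> G" for x
  proof -
    have x: "x \<in> cyl n x"
      using that by (simp add: mem_cyl_iff)
    have zero: "indicator A x *\<^sub>R f x = 0" if "A \<in> cyl n ` G - {cyl n x}" for A
    proof -
      have "x \<notin> A"
        using that cyl_eq by fastforce
      then show ?thesis by simp
    qed
    have "(SOME y. y \<in> cyl n x) \<in> cyl n x"
      by (rule someI[where P = "\<lambda>y. y \<in> cyl n x", OF x])
    then have "g (SOME y. y \<in> cyl n x) = g x"
      using g that by blast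
    moreover have "(\<Sum>A\<in>cyl n ` G. g (SOME x. x \<in> A) * (indicator A x *\<^sub>R f x))
        = (\<Sum>A\<in>{cyl n x}. g (SOME x. x \<in> A) * (indicator A x *\<^sub>R f x))"
      using that zero finite_cyls by (intro sum.mono_neutral_right) auto
    ultimately show ?thesis
      using x by simp
  qed
  then have "(\<integral>x. f x * g x \<partial>\<mu>)
      = (\<integral>x. (\<Sum>A\<in>cyl n ` G. g (SOME x. x \<in> A) * (indicator A x *\<^sub>R f x)) \<partial>\<mu>)"
    by (intro Bochner_Integration.integral_cong) (auto simp: space_vil_measure)
  also have "\<dots> = (\<Sum>A\<in>cyl n ` G. (\<integral>x. g (SOME x. x \<in> A) * (indicator A x *\<^sub>R f x) \<partial>\<mu>))"
    using f by (intro Bochner_Integration.integral_sum integrable_mult_right integrable_mult_indicator) auto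
  finally show ?thesis
    by (simp only: set_lebesgue_integral_def integral_mult_right_zero)
qed

lemma martingale_integral_mult:
  assumes "vil_martingale m f" "K \<le> k"
    and "\<And>x y. x \<in> G \<Longrightarrow> y \<in> cyl K x \<Longrightarrow> g y = g x"
  shows "(\<integral>x. f k x * g x \<partial>\<mu>) = (\<integral>x. f K x * g x \<partial>\<mu>)"
proof -
  have "integrable \<mu> (f k)" "integrable \<mu> (f K)"
    and "\<And>A. A \<in> sets (vil_filtration m K) \<Longrightarrow> (LINT x:A|\<mu>. f k x) = (LINT x:A|\<mu>. f K x)"
    using assms(1,2) unfolding vil_martingale_def by blast+
  then show ?thesis
    using assms(3) cyl_in_filtration
    by (auto simp: integral_mult_cyl_const[where n = K] intro!: sum.cong)
qed

text \<open>\<open>\<psi> i\<close> is constant on cylinders of rank \<open>K\<close>, so the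
  sequence defining the coefficient is constant from \<open>K\<close> on.\<close>

lemma vil_coeff_eq:
  assumes "vil_martingale m f" "i < M K"
  shows "vil_coeff m f i = (\<integral>x. f K x * cnj (\<psi> i x) \<partial>\<mu>)"
proof -
  have "(\<integral>x. f k x * cnj (\<psi> i x) \<partial>\<mu>) = (\<integral>x. f K x * cnj (\<psi> i x) \<partial>\<mu>)" if "K \<le> k" for k
    using assms(1) that
    by (rule martingale_integral_mult) (auto simp: mem_cyl_iff intro: psi_cong[OF assms(2)])
  then have "(\<lambda>k. \<integral>x. f k x * cnj (\<psi> i x) \<partial>\<mu>) \<longlonglongrightarrow> (\<integral>x. f K x * cnj (\<psi> i x) \<partial>\<mu>)"
    by (intro tendsto_eventually eventually_sequentiallyI)
  then show ?thesis
    unfolding vil_coeff_def by (rule limI)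
qed

lemma martingale_cyl_const:
  assumes "vil_martingale m f" "x \<in> G" "y \<in> cyl K x"
  shows "f K y = f K x"
  using assms filtration_measurable_const unfolding vil_martingale_def by blast

lemma integrable_mult_psi:
  assumes "integrable \<mu> f"
  shows "integrable \<mu> (\<lambda>t. f t * (c * cnj (\<psi> i t)))"
proof -
  have [measurable]: "f \<in> borel_measurable \<mu>"
    using assms by auto
  have [measurable]: "cnj \<in> borel_measurable borel"
    by (intro borel_measurable_continuous_onI continuous_intros)
  have "integrable \<mu> (\<lambda>t. f t * cnj (\<psi> i t))"
    by (rule Bochner_Integration.integrable_bound[OF assms]) (auto simp: norm_mult)
  then have "integrable \<mu> (\<lambda>t. c * (f t * cnj (\<psi> i t)))"
    by (rule integrable_mult_right)
  then show ?thesis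
    by (simp add: ac_simps)
qed

lemma partial_sum_eq_integral:
  assumes f: "vil_martingale m f" and n: "n \<le> M K"
  shows "vil_partial_sum m f n x = (\<integral>t. f K t * kernel n x t \<partial>\<mu>)"
proof -
  have int: "integrable \<mu> (f K)"
    using f by (simp add: vil_martingale_def)
  have "vil_partial_sum m f n x = (\<Sum>i<n. (\<integral>t. f K t * (\<psi> i x * cnj (\<psi> i t)) \<partial>\<mu>))"
    unfolding vil_partial_sum_def
  proof (rule sum.cong)
    fix i assume "i \<in> {..<n}"
    then have "vil_coeff m f i * \<psi> i x = (\<integral>t. f K t * cnj (\<psi> i t) * \<psi> i x \<partial>\<mu>)"
      using n vil_coeff_eq[OF f, of i K] by simp
    also have "\<dots> = (\<integral>t. f K t * (\<psi> i x * cnj (\<psi> i t)) \<partial>\<mu>)"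
      by (simp only: ac_simps)
    finally show "vil_coeff m f i * \<psi> i x = (\<integral>t. f K t * (\<psi> i x * cnj (\<psi> i t)) \<partial>\<mu>)" .
  qed simp
  also have "\<dots> = (\<integral>t. f K t * kernel n x t \<partial>\<mu>)"
    unfolding kernel_def sum_distrib_left
    by (rule Bochner_Integration.integral_sum[symmetric]) (rule integrable_mult_psi[OF int])
  finally show ?thesis .
qed

text \<open>The inclusion of \<open>\<ell>\<^sub>p\<close> in \<open>\<ell>\<^sub>1\<close>, applied to the values of \<open>u\<close> on the cylinders of rank \<open>K\<close>.\<close>

lemma cyl_integral_le:
  fixes u :: "(nat \<Rightarrow> nat) \<Rightarrow> real"
  assumes u: "integrable \<mu> u" "\<And>t. 0 \<le> u t"
    and const: "\<And>t y. t \<in> G \<Longrightarrow> y \<in> cyl K t \<Longrightarrow> u y = u t"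
    and p: "0 < p" "p < 1" and x: "x \<in> G" and j: "j \<le> K" and g: "0 \<le> g"
    and le: "(\<integral>\<^sup>+ t. ennreal (u t powr p) * indicator (cyl j x) t \<partial>\<mu>) \<le> ennreal g"
  shows "(\<integral>t. u t * indicator (cyl j x) t \<partial>\<mu>) \<le> M K powr (1 / p - 1) * g powr (1 / p)"
proof -
  have [measurable]: "u \<in> borel_measurable \<mu>"
    using u by auto
  \<comment> \<open>The cylinder of rank \<open>K\<close> around \<open>t\<close> lies in
    \<open>cyl j x\<close>, and \<open>u powr p\<close> is constant on it; its share of the integral
    is already \<open>u t powr p / M K\<close>.\<close>
  have bound: "u t powr p \<le> M K * g" if t: "t \<in> cyl j x" for t
  proof -
    have tG: "t \<in> G"
      using t cyl_subset_group by blast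
    have "ennreal (u t powr p / M K) = (\<integral>\<^sup>+ s. ennreal (u t powr p) * indicator (cyl K t) s \<partial>\<mu>)"
      by (simp add: nn_integral_cmult emeasure_cyl[OF tG] flip: ennreal_mult)
    also have "\<dots> \<le> (\<integral>\<^sup>+ s. ennreal (u s powr p) * indicator (cyl j x) s \<partial>\<mu>)"
    proof (rule nn_integral_mono)
      fix s
      show "ennreal (u t powr p) * indicator (cyl K t) s \<le> ennreal (u s powr p) * indicator (cyl j x) s"
        using const[OF tG, of s] cyl_antimono[OF j, of t] cyl_eq[OF t order.refl]
        by (auto simp: indicator_def)
    qed
    also note le
    finally have "u t powr p / M K \<le> g"
      using g by simp
    then show ?thesis
      by (simp add: field_simps)
  qed
  \<comment> \<open>In the factorization \<open>u = (u powr p) powr (1 / p - 1) * u powr p\<close>,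
    the constant \<open>U\<close> bounds the first factor; its exponent is positive as
    \<open>p < 1\<close>.\<close>
  define U where "U = (M K * g) powr (1 / p - 1)"
  have "u t \<le> U * u t powr p" if t: "t \<in> cyl j x" for t
  proof (cases "u t = 0")
    case False
    have "u t = (u t powr p) powr (1 / p - 1) * u t powr p"
      using p u(2)[of t] False by (simp add: powr_powr powr_add[symmetric] field_simps)
    also have "\<dots> \<le> U * u t powr p"
      unfolding U_def using p bound[OF t] by (intro mult_right_mono powr_mono2) (auto simp: field_simps)
    finally show ?thesis .
  qed (simp add: U_def)
  then have *: "u t * indicator (cyl j x) t \<le> U * (u t powr p * indicator (cyl j x) t)" for t
    by (auto simp: indicator_def)
  have "ennreal (\<integral>t. u t * indicator (cyl j x) t \<partial>\<mu>) = (\<integral>\<^sup>+ t. ennreal (u t * indicator (cyl j x) t) \<partial>\<mu>)"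
    using u by (intro nn_integral_eq_integral[symmetric] integrable_real_mult_indicator[OF cyl_sets]) auto
  also have "\<dots> \<le> (\<integral>\<^sup>+ t. ennreal U * (ennreal (u t powr p) * indicator (cyl j x) t) \<partial>\<mu>)"
  proof (rule nn_integral_mono)
    fix t
    have "ennreal (u t * indicator (cyl j x) t) \<le> ennreal (U * (u t powr p * indicator (cyl j x) t))"
      by (rule ennreal_leI) (rule *)
    also have "\<dots> = ennreal U * (ennreal (u t powr p) * indicator (cyl j x) t)"
      by (simp add: U_def ennreal_mult ennreal_indicator)
    finally show "ennreal (u t * indicator (cyl j x) t) \<le> \<dots>" .
  qed
  also have "\<dots> = ennreal U * (\<integral>\<^sup>+ t. ennreal (u t powr p) * indicator (cyl j x) t \<partial>\<mu>)"
    by (rule nn_integral_cmult) measurable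
  also have "\<dots> \<le> ennreal U * ennreal g"
    by (intro mult_left_mono le) simp
  also have "\<dots> = ennreal (U * g)"
    using g by (simp add: ennreal_mult U_def)
  finally have "(\<integral>t. u t * indicator (cyl j x) t \<partial>\<mu>) \<le> U * g"
    using g by (simp add: U_def)
  also have "U * g = M K powr (1 / p - 1) * g powr (1 / p)"
  proof (cases "g = 0")
    case False
    with g show ?thesis
      by (simp add: U_def powr_mult powr_diff)
  qed (simp add: U_def)
  finally show ?thesis .
qed

end

section \<open>Domination of the partial sums in the bounded case\<close>

locale bounded_vilenkin = vilenkin +
  fixes B :: nat
  assumes le_B: "m k \<le> B"
begin

lemma B_ge: "2 \<le> B"
  using two_le[of 0] le_B[of 0] by linarith

lemma M_Suc_le: "M (Suc k) \<le> B * M k"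
  by (simp add: M_Suc le_B)

text \<open>A single term suffices. On \<open>cyl K x\<close> it is the one with
  \<open>j = K\<close>, by the trivial bound \<open>n\<close>. Otherwise \<open>t\<close> leaves the
  cylinders around \<open>x\<close> at a first rank \<open>Suc j\<close>, where the kernel is at
  most \<open>M (Suc j) \<le> B * M j\<close>.\<close>

lemma norm_kernel_le_sum:
  assumes "x \<in> G" "t \<in> G" "n \<le> M K"
  shows "cmod (kernel n x t) \<le> (\<Sum>j\<le>K. real (B * M j) * indicator (cyl j x) t)"
proof -
  have *: "cmod (kernel n x t) \<le> (\<Sum>j\<le>K. real (B * M j) * indicator (cyl j x) t)"
    if "j \<le> K" "t \<in> cyl j x" "cmod (kernel n x t) \<le> B * M j" for j
  proof -
    have "cmod (kernel n x t) \<le> real (B * M j) * indicator (cyl j x) t"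
      using that by simp
    also have "\<dots> \<le> (\<Sum>j\<le>K. real (B * M j) * indicator (cyl j x) t)"
      using that(1) by (intro member_le_sum[of j "{..K}" "\<lambda>j. real (B * M j) * indicator (cyl j x) t"]) auto
    finally show ?thesis .
  qed
  show ?thesis
  proof (cases "t \<in> cyl K x")
    case True
    have "1 * n \<le> B * M K"
      using assms(3) B_ge by (intro mult_le_mono) auto
    then have "real n \<le> real (B * M K)"
      by (simp only: of_nat_le_iff mult_1)
    then show ?thesis
      using norm_kernel_le[of n x t] by (intro *[OF _ True]) (auto simp del: of_nat_mult)
  next
    case False
    define s where "s = (LEAST s. t \<notin> cyl s x)"
    have s: "t \<notin> cyl s x" "s \<le> K"
      unfolding s_def using False by (rule LeastI, rule Least_le)
    have "s \<noteq> 0"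
      using s(1) assms(2) by (auto simp: mem_cyl_iff intro: ccontr)
    then obtain j where j: "s = Suc j"
      by (cases s) auto
    have "t \<in> cyl j x"
      using not_less_Least[of j "\<lambda>s. t \<notin> cyl s x"] unfolding s_def[symmetric] j by simp
    moreover have "cmod (kernel n x t) \<le> B * M j"
      using norm_kernel_le_M[OF assms(1,2) s(1)] M_Suc_le[of j] unfolding j
      by (meson of_nat_mono order_trans)
    ultimately show ?thesis
      using s(2) j by (intro *[of j]) auto
  qed
qed

text \<open>The least \<open>K\<close> with \<open>n \<le> M K\<close> works: the preceding
  \<open>M j\<close> is below \<open>n\<close>, and one step multiplies by at most
  \<open>B\<close>.\<close>

lemma M_approx:
  assumes "1 \<le> n"
  obtains K where "n \<le> M K" "M K \<le> B * n"
proof -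
  define K where "K = (LEAST K. n \<le> M K)"
  have "n \<le> M n"
    using less_M[of n] by simp
  then have le: "n \<le> M K"
    unfolding K_def by (rule LeastI)
  show ?thesis
  proof (cases K)
    case 0
    have "M K \<le> B * n"
      using B_ge assms 0 by simp
    with le that show ?thesis by blast
  next
    case (Suc j)
    then have "M j \<le> n"
      using not_less_Least[of j "\<lambda>K. n \<le> M K"] unfolding K_def[symmetric] by simp
    then have "M K \<le> B * n"
      unfolding Suc using M_Suc_le[of j] by (meson le_trans mult_le_mono2)
    with le that show ?thesis by blast
  qed
qed

definition local_mass :: "((nat \<Rightarrow> nat) \<Rightarrow> ennreal) \<Rightarrow> nat \<Rightarrow> (nat \<Rightarrow> nat) \<Rightarrow> ennreal" where
  "local_mass h j x = (\<integral>\<^sup>+ t. h t * indicator (cyl j x) t \<partial>\<mu>)"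

text \<open>For \<open>h\<close> the \<open>p\<close>-th power of the maximal function, this
  dominates all weighted partial sums at once. Values in \<open>ennreal\<close> allow it to be
  infinite at some points.\<close>

definition mass_sum :: "real \<Rightarrow> ((nat \<Rightarrow> nat) \<Rightarrow> ennreal) \<Rightarrow> (nat \<Rightarrow> nat) \<Rightarrow> ennreal" where
  "mass_sum p h x = (\<Sum>j. ennreal (M j powr p) * local_mass h j x)"

text \<open>The kernel bound reduces the partial sum to integrals of \<open>cmod (f K t)\<close>
  over the cylinders around \<open>x\<close>, and \<open>cyl_integral_le\<close> estimates each of
  them by the local mass.\<close>

lemma norm_partial_sum_le:
  fixes R :: real
  assumes f: "vil_martingale m f" and p: "0 < p" "p < 1" and x: "x \<in> G"
    and R: "mass_sum p (\<lambda>t. epowr (maximal_fun f t) p) x = ennreal R" "0 \<le> R" and n: "1 \<le> n"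
  shows "cmod (vil_partial_sum m f n x) \<le> (B * R) powr (1 / p) * n powr (1 / p - 1)"
proof -
  define h where "h t = epowr (maximal_fun f t) p" for t
  define g where "g j = enn2real (local_mass h j x)" for j
  have mass_le: "ennreal (M j powr p) * local_mass h j x \<le> ennreal R" for j
    unfolding R(1)[symmetric] mass_sum_def h_def
    using sum_le_suminf[of "\<lambda>j. ennreal (M j powr p) * local_mass (\<lambda>t. epowr (maximal_fun f t) p) j x" "{j}"]
    by simp
  \<comment> \<open>The factor \<open>M j powr p\<close> is positive, so a finite product forces a
    finite local mass.\<close>
  have g: "local_mass h j x = ennreal (g j)" for j
  proof -
    have "local_mass h j x \<noteq> \<infinity>"
      using mass_le[of j] by (auto simp: ennreal_mult_top top_unique)
    then show ?thesis
      by (simp add: g_def less_top)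
  qed
  have g0: "0 \<le> g j" for j
    by (simp add: g_def)
  obtain K where K: "n \<le> M K" "M K \<le> B * n"
    using M_approx[OF n] .
  define u where "u t = cmod (f K t)" for t
  have int: "integrable \<mu> (f K)"
    using f by (simp add: vil_martingale_def)
  then have int_u: "integrable \<mu> u"
    unfolding u_def by (rule integrable_norm)
  have int_j: "integrable \<mu> (\<lambda>t. u t * indicator (cyl j x) t)" for j
    using int_u by (rule integrable_real_mult_indicator[OF cyl_sets])
  have [measurable]: "f K \<in> borel_measurable \<mu>"
    using int by auto
  have u_le: "ennreal (u t powr p) \<le> h t" for t
  proof -
    have "ennreal (u t powr p) = epowr (ennreal (u t)) p"
      by (simp add: epowr_ennreal u_def)
    also have "\<dots> \<le> h t"
      unfolding h_def u_def maximal_fun_def using p by (intro epowr_mono SUP_upper) auto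
    finally show ?thesis .
  qed
  have local: "(\<integral>t. u t * indicator (cyl j x) t \<partial>\<mu>) \<le> M K powr (1 / p - 1) * g j powr (1 / p)"
    if "j \<le> K" for j
  proof (rule cyl_integral_le[OF int_u _ _ p x that g0])
    show "(\<integral>\<^sup>+ t. ennreal (u t powr p) * indicator (cyl j x) t \<partial>\<mu>) \<le> ennreal (g j)"
      unfolding g[symmetric] local_mass_def by (intro nn_integral_mono mult_right_mono u_le) simp
  qed (auto simp: u_def martingale_cyl_const[OF f])
  have "cmod (vil_partial_sum m f n x) \<le> (\<integral>t. cmod (f K t * kernel n x t) \<partial>\<mu>)"
    unfolding partial_sum_eq_integral[OF f K(1)] by (rule integral_norm_bound)
  also have "\<dots> \<le> (\<integral>t. (\<Sum>j\<le>K. real (B * M j) * (u t * indicator (cyl j x) t)) \<partial>\<mu>)"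
  proof (rule integral_mono_AE')
    show "integrable \<mu> (\<lambda>t. \<Sum>j\<le>K. real (B * M j) * (u t * indicator (cyl j x) t))"
      by (intro Bochner_Integration.integrable_sum integrable_mult_right int_j)
    show "AE t in \<mu>. cmod (f K t * kernel n x t) \<le> (\<Sum>j\<le>K. real (B * M j) * (u t * indicator (cyl j x) t))"
    proof (rule AE_I2)
      fix t assume "t \<in> space \<mu>"
      then have "t \<in> G" by (simp add: space_vil_measure)
      have "cmod (f K t * kernel n x t) \<le> u t * (\<Sum>j\<le>K. real (B * M j) * indicator (cyl j x) t)"
        unfolding norm_mult u_def
        by (intro mult_left_mono norm_kernel_le_sum[OF x \<open>t \<in> G\<close> K(1)]) simp
      then show "cmod (f K t * kernel n x t) \<le> (\<Sum>j\<le>K. real (B * M j) * (u t * indicator (cyl j x) t))"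
        by (simp add: sum_distrib_left ac_simps)
    qed
    show "AE t in \<mu>. 0 \<le> (\<Sum>j\<le>K. real (B * M j) * (u t * indicator (cyl j x) t))"
      by (intro AE_I2 sum_nonneg) (auto simp: u_def)
  qed
  also have "\<dots> = (\<Sum>j\<le>K. real (B * M j) * (\<integral>t. u t * indicator (cyl j x) t \<partial>\<mu>))"
    using int_j by (subst Bochner_Integration.integral_sum) auto
  also have "\<dots> \<le> (\<Sum>j\<le>K. real (B * M j) * (M K powr (1 / p - 1) * g j powr (1 / p)))"
    by (intro sum_mono mult_left_mono local) auto
  \<comment> \<open>The weight \<open>M j\<close> equals \<open>(M j powr p) powr (1 / p)\<close>
    and moves inside the power, ready for \<open>sum_powr_le_powr_sum\<close> with exponent
    \<open>1 / p\<close>.\<close>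
  also have "\<dots> = B * M K powr (1 / p - 1) * (\<Sum>j\<le>K. (M j powr p * g j) powr (1 / p))"
    using p by (simp add: sum_distrib_left powr_mult powr_powr g0 ac_simps)
  also have "\<dots> \<le> B * M K powr (1 / p - 1) * (\<Sum>j\<le>K. M j powr p * g j) powr (1 / p)"
    using p g0 by (intro mult_left_mono sum_powr_le_powr_sum) auto
  also have "\<dots> \<le> B * (B * n) powr (1 / p - 1) * R powr (1 / p)"
  proof (intro mult_mono powr_mono2)
    have "ennreal (\<Sum>j\<le>K. M j powr p * g j) = (\<Sum>j\<le>K. ennreal (M j powr p) * local_mass h j x)"
      using g0 by (simp add: g ennreal_mult flip: sum_ennreal)
    also have "\<dots> \<le> ennreal R"
      unfolding R(1)[symmetric] mass_sum_def h_def by (rule sum_le_suminf) auto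
    finally show "(\<Sum>j\<le>K. M j powr p * g j) \<le> R"
      using R(2) by simp
    show "real (M K) \<le> real (B * n)"
      using K(2) by (simp only: of_nat_le_iff)
  qed (use p g0 in \<open>auto simp: field_simps intro!: sum_nonneg\<close>)
  \<comment> \<open>The factor \<open>B\<close> from the kernel and
    \<open>B powr (1 / p - 1)\<close> from \<open>M K \<le> B * n\<close> combine to
    \<open>B powr (1 / p)\<close>.\<close>
  also have "\<dots> = (B * R) powr (1 / p) * n powr (1 / p - 1)"
    using R(2) B_ge by (simp add: powr_mult powr_diff)
  finally show ?thesis .
qed

text \<open>The weights \<open>1 / (n - k)\<close> add up to \<open>harm n\<close>, so the mean is
  an average of partial sums; the one of order 0 is zero.\<close>

lemma norm_log_mean_le:
  assumes "\<And>k. 1 \<le> k \<Longrightarrow> k < n \<Longrightarrow> cmod (vil_partial_sum m f k x) \<le> Q" "0 \<le> Q"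
  shows "cmod (vil_log_mean m f n x) \<le> Q"
proof (cases "n = 0")
  case False
  have S: "cmod (vil_partial_sum m f k x) \<le> Q" if "k < n" for k
    using assms that by (cases "k = 0") (auto simp: vil_partial_sum_def)
  have "cmod (\<Sum>k<n. vil_partial_sum m f k x / of_nat (n - k)) \<le> (\<Sum>k<n. Q / real (n - k))"
  proof (rule sum_norm_le)
    fix k assume "k \<in> {..<n}"
    then show "cmod (vil_partial_sum m f k x / of_nat (n - k)) \<le> Q / real (n - k)"
      using S[of k] by (simp add: norm_divide divide_right_mono del: of_nat_diff)
  qed
  also have "\<dots> = Q * harm n"
  proof -
    have "(\<Sum>k<n. Q / real (n - k)) = (\<Sum>k=1..n. Q / real k)"
      by (rule sum.reindex_bij_witness[of _ "\<lambda>k. n - k" "\<lambda>k. n - k"]) auto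
    then show ?thesis
      by (simp add: harm_def sum_distrib_left divide_inverse)
  qed
  finally show ?thesis
    using False by (simp add: vil_log_mean_def norm_divide norm_harm divide_le_eq)
qed (simp add: vil_log_mean_def assms)

text \<open>Where the mass sum is a finite \<open>R\<close>, all quotients are at most
  \<open>Q\<close>, and \<open>Q powr p = B * R\<close>; elsewhere the right-hand side is
  infinite.\<close>

lemma log_mean_maximal_le:
  assumes f: "vil_martingale m f" and p: "0 < p" "p < 1" and x: "x \<in> G"
  shows "epowr (log_mean_maximal m (\<lambda>n. real n powr (1 / p - 1)) f x) p
    \<le> ennreal B * mass_sum p (\<lambda>t. epowr (maximal_fun f t) p) x"
proof (cases "mass_sum p (\<lambda>t. epowr (maximal_fun f t) p) x")
  case (real R)
  define Q where "Q = (B * R) powr (1 / p)"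
  have "log_mean_maximal m (\<lambda>n. real n powr (1 / p - 1)) f x \<le> ennreal Q"
    unfolding log_mean_maximal_def
  proof (rule SUP_least, rule ennreal_leI)
    fix n
    have "cmod (vil_log_mean m f n x) \<le> Q * real (n + 1) powr (1 / p - 1)"
    proof (rule norm_log_mean_le)
      fix k :: nat
      assume k: "1 \<le> k" "k < n"
      have "cmod (vil_partial_sum m f k x) \<le> Q * k powr (1 / p - 1)"
        unfolding Q_def using real k(1) by (intro norm_partial_sum_le[OF f p x]) auto
      also have "\<dots> \<le> Q * real (n + 1) powr (1 / p - 1)"
        using k p by (intro mult_left_mono powr_mono2) (auto simp: Q_def)
      finally show "cmod (vil_partial_sum m f k x) \<le> Q * real (n + 1) powr (1 / p - 1)" .
    qed (simp add: Q_def)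
    then show "cmod (vil_log_mean m f n x) / real (n + 1) powr (1 / p - 1) \<le> Q"
      by (simp add: divide_le_eq)
  qed
  then have "epowr (log_mean_maximal m (\<lambda>n. real n powr (1 / p - 1)) f x) p \<le> epowr (ennreal Q) p"
    using p by (intro epowr_mono) auto
  also have "\<dots> = ennreal (B * R)"
    using p real by (simp add: epowr_ennreal Q_def powr_powr)
  finally show ?thesis
    using real by (simp add: ennreal_mult ennreal_of_nat_eq_real_of_nat)
next
  case top
  then show ?thesis
    using B_ge by (simp add: ennreal_mult_top)
qed

text \<open>The relation \<open>t \<in> cyl j x\<close> is symmetric on the group; after exchanging
  the integrals, the inner one is the measure \<open>1 / M j\<close> of a cylinder.\<close>

lemma nn_integral_local_mass:
  assumes [measurable]: "h \<in> borel_measurable \<mu>"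
  shows "local_mass h j \<in> borel_measurable \<mu>"
    and "(\<integral>\<^sup>+ x. local_mass h j x \<partial>\<mu>) = (\<integral>\<^sup>+ x. h x \<partial>\<mu>) * ennreal (1 / M j)"
proof -
  interpret P: pair_sigma_finite \<mu> \<mu> ..
  define E where "E = {z \<in> space (\<mu> \<Otimes>\<^sub>M \<mu>). \<forall>i<j. snd z i = fst z i}"
  have E [measurable]: "E \<in> sets (\<mu> \<Otimes>\<^sub>M \<mu>)"
  proof -
    have [measurable]: "(\<lambda>z. fst z i) \<in> \<mu> \<Otimes>\<^sub>M \<mu> \<rightarrow>\<^sub>M count_space UNIV"
      "(\<lambda>z. snd z i) \<in> \<mu> \<Otimes>\<^sub>M \<mu> \<rightarrow>\<^sub>M count_space UNIV" for i
      by (rule measurable_compose[OF measurable_fst measurable_coordinate]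
          measurable_compose[OF measurable_snd measurable_coordinate])+
    \<comment> \<open>Coordinates are compared as reals so that the equality set is covered by
      \<open>borel_measurable_eq\<close>.\<close>
    have "(\<lambda>z. real (fst z i)) \<in> borel_measurable (\<mu> \<Otimes>\<^sub>M \<mu>)"
      "(\<lambda>z. real (snd z i)) \<in> borel_measurable (\<mu> \<Otimes>\<^sub>M \<mu>)" for i
      by measurable
    then have "{z \<in> space (\<mu> \<Otimes>\<^sub>M \<mu>). real (snd z i) = real (fst z i)} \<in> sets (\<mu> \<Otimes>\<^sub>M \<mu>)" for i
      by (intro borel_measurable_eq)
    then have "{z \<in> space (\<mu> \<Otimes>\<^sub>M \<mu>). \<forall>i\<in>{..<j}. real (snd z i) = real (fst z i)} \<in> sets (\<mu> \<Otimes>\<^sub>M \<mu>)"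
      by (intro sets.sets_Collect_finite_All) simp_all
    then show ?thesis
      unfolding E_def by (simp only: of_nat_eq_iff Ball_def lessThan_iff)
  qed
  have [measurable]: "(\<lambda>z. h (snd z) * indicator E z) \<in> borel_measurable (\<mu> \<Otimes>\<^sub>M \<mu>)"
    by (intro borel_measurable_times_ennreal borel_measurable_indicator E
        measurable_compose[OF measurable_snd assms])
  then have prod: "(\<lambda>(x, t). h t * indicator E (x, t)) \<in> borel_measurable (\<mu> \<Otimes>\<^sub>M \<mu>)"
    by (simp add: case_prod_beta')
  have mem: "(x, t) \<in> E \<longleftrightarrow> t \<in> cyl j x" "(x, t) \<in> E \<longleftrightarrow> x \<in> cyl j t" if "x \<in> G" "t \<in> G" for x t
    using that by (auto simp: E_def mem_cyl_iff space_pair_measure space_vil_measure)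
  have eq: "local_mass h j x = (\<integral>\<^sup>+ t. h t * indicator E (x, t) \<partial>\<mu>)" if "x \<in> space \<mu>" for x
    unfolding local_mass_def using that
    by (intro nn_integral_cong) (simp add: indicator_def mem(1) space_vil_measure)
  have "(\<lambda>x. \<integral>\<^sup>+ t. h t * indicator E (x, t) \<partial>\<mu>) \<in> borel_measurable \<mu>"
    using borel_measurable_nn_integral[OF prod] by simp
  then show "local_mass h j \<in> borel_measurable \<mu>"
    by (simp cong: measurable_cong add: eq)
  have "(\<integral>\<^sup>+ x. local_mass h j x \<partial>\<mu>) = (\<integral>\<^sup>+ x. (\<integral>\<^sup>+ t. h t * indicator E (x, t) \<partial>\<mu>) \<partial>\<mu>)"
    by (rule nn_integral_cong) (rule eq)
  also have "\<dots> = (\<integral>\<^sup>+ t. (\<integral>\<^sup>+ x. h t * indicator E (x, t) \<partial>\<mu>) \<partial>\<mu>)"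
    by (rule P.Fubini'[symmetric]) (rule prod)
  also have "\<dots> = (\<integral>\<^sup>+ t. h t * ennreal (1 / M j) \<partial>\<mu>)"
  proof (rule nn_integral_cong)
    fix t assume "t \<in> space \<mu>"
    then have t: "t \<in> G" by (simp add: space_vil_measure)
    have "(\<integral>\<^sup>+ x. h t * indicator E (x, t) \<partial>\<mu>) = (\<integral>\<^sup>+ x. h t * indicator (cyl j t) x \<partial>\<mu>)"
      using t by (intro nn_integral_cong) (simp add: indicator_def mem(2) space_vil_measure)
    then show "(\<integral>\<^sup>+ x. h t * indicator E (x, t) \<partial>\<mu>) = h t * ennreal (1 / M j)"
      by (simp add: nn_integral_cmult emeasure_cyl[OF t])
  qed
  also have "\<dots> = (\<integral>\<^sup>+ x. h x \<partial>\<mu>) * ennreal (1 / M j)"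
    by (rule nn_integral_multc) (rule assms)
  finally show "(\<integral>\<^sup>+ x. local_mass h j x \<partial>\<mu>) = (\<integral>\<^sup>+ x. h x \<partial>\<mu>) * ennreal (1 / M j)" .
qed

text \<open>Term \<open>j\<close> integrates to \<open>M j powr (p - 1)\<close> times the total
  mass. Since \<open>M j \<ge> 2 ^ j\<close> and \<open>p < 1\<close>, a geometric series of ratio
  \<open>2 powr (p - 1)\<close> dominates.\<close>

lemma nn_integral_mass_sum:
  assumes [measurable]: "h \<in> borel_measurable \<mu>" and "p < 1"
  shows "(\<integral>\<^sup>+ x. mass_sum p h x \<partial>\<mu>) \<le> ennreal (1 / (1 - 2 powr (p - 1))) * (\<integral>\<^sup>+ x. h x \<partial>\<mu>)"
proof -
  note [measurable] = nn_integral_local_mass(1)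
  define q :: real where "q = 2 powr (p - 1)"
  have q: "0 \<le> q" "q < 1"
    using assms(2) by (auto simp: q_def powr_less_one)
  have le: "M j powr p * (1 / M j) \<le> q ^ j" for j
  proof -
    have "M j powr p * (1 / M j) = M j powr (p - 1)"
      by (simp add: powr_diff)
    also have "\<dots> \<le> (2 ^ j) powr (p - 1)"
      using assms(2) two_power_le_M[of j] by (intro powr_mono2') (auto simp flip: of_nat_power)
    also have "\<dots> = q ^ j"
      by (simp add: q_def powr_powr powr_realpow[symmetric] mult.commute)
    finally show ?thesis .
  qed
  have "(\<integral>\<^sup>+ x. mass_sum p h x \<partial>\<mu>) = (\<Sum>j. \<integral>\<^sup>+ x. ennreal (M j powr p) * local_mass h j x \<partial>\<mu>)"
    unfolding mass_sum_def by (rule nn_integral_suminf) measurable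
  also have "\<dots> = (\<Sum>j. ennreal (M j powr p * (1 / M j)) * (\<integral>\<^sup>+ x. h x \<partial>\<mu>))"
  proof (rule suminf_cong)
    fix j
    show "(\<integral>\<^sup>+ x. ennreal (M j powr p) * local_mass h j x \<partial>\<mu>)
        = ennreal (M j powr p * (1 / M j)) * (\<integral>\<^sup>+ x. h x \<partial>\<mu>)"
      by (subst nn_integral_cmult)
        (simp_all add: nn_integral_local_mass ennreal_mult del: times_divide_eq_right, simp add: ac_simps)
  qed
  also have "\<dots> = (\<Sum>j. ennreal (M j powr p * (1 / M j))) * (\<integral>\<^sup>+ x. h x \<partial>\<mu>)"
    by (rule ennreal_suminf_multc)
  also have "\<dots> \<le> (\<Sum>j. ennreal (q ^ j)) * (\<integral>\<^sup>+ x. h x \<partial>\<mu>)"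
    by (intro mult_right_mono suminf_le ennreal_leI le) auto
  also have "(\<Sum>j. ennreal (q ^ j)) = ennreal (1 / (1 - q))"
    using q by (simp add: suminf_ennreal2 summable_geometric suminf_geometric)
  finally show ?thesis
    by (simp add: q_def)
qed

lemma bounded_log_mean_maximal:
  assumes p: "0 < p" "p < 1"
  shows "bounded_Hp_Lp m p (log_mean_maximal m (\<lambda>n. real n powr (1 / p - 1)))"
  unfolding bounded_Hp_Lp_def
proof (intro exI ballI)
  fix f assume "f \<in> vil_Hp m p"
  then have f: "vil_martingale m f"
    by (simp add: vil_Hp_def)
  define h where "h t = epowr (maximal_fun f t) p" for t
  define D where "D = 1 / (1 - 2 powr (p - 1))"
  have "2 powr (p - 1) < (1::real)"
    using p by (simp add: powr_less_one)
  then have D: "0 < D"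
    by (simp add: D_def)
  have [measurable]: "f n \<in> borel_measurable \<mu>" for n
    using f filtration_measurable_imp[of "f n" n] by (simp add: vil_martingale_def)
  have [measurable]: "h \<in> borel_measurable \<mu>"
    unfolding h_def[abs_def] maximal_fun_def by measurable
  have [measurable]: "local_mass h j \<in> borel_measurable \<mu>" for j
    by (rule nn_integral_local_mass) measurable
  have "(\<integral>\<^sup>+ x. epowr (log_mean_maximal m (\<lambda>n. real n powr (1 / p - 1)) f x) p \<partial>\<mu>)
      \<le> (\<integral>\<^sup>+ x. ennreal B * mass_sum p h x \<partial>\<mu>)"
    unfolding h_def using log_mean_maximal_le[OF f p]
    by (intro nn_integral_mono) (simp add: space_vil_measure)
  also have "\<dots> = ennreal B * (\<integral>\<^sup>+ x. mass_sum p h x \<partial>\<mu>)"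
    unfolding mass_sum_def by (rule nn_integral_cmult) measurable
  also have "\<dots> \<le> ennreal B * (ennreal D * (\<integral>\<^sup>+ x. h x \<partial>\<mu>))"
    unfolding D_def using p by (intro mult_left_mono nn_integral_mass_sum) auto
  also have "\<dots> = ennreal (B * D) * (\<integral>\<^sup>+ x. h x \<partial>\<mu>)"
    using D by (simp add: ennreal_mult mult.assoc)
  finally have "vil_Lp_norm m p (log_mean_maximal m (\<lambda>n. real n powr (1 / p - 1)) f)
      \<le> epowr (ennreal (B * D) * (\<integral>\<^sup>+ x. h x \<partial>\<mu>)) (1 / p)"
    unfolding vil_Lp_norm_def using p by (intro epowr_mono) auto
  also have "\<dots> = ennreal ((B * D) powr (1 / p)) * vil_Hp_norm m p f"
    unfolding vil_Hp_norm_def vil_Lp_norm_def h_def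
    using p D B_ge by (intro epowr_mult_const) auto
  \<comment> \<open>\<open>D\<close> is written out to exhibit a constant independent of
    \<open>f\<close>.\<close>
  finally show "vil_Lp_norm m p (log_mean_maximal m (\<lambda>n. real n powr (1 / p - 1)) f)
      \<le> ennreal ((B * (1 / (1 - 2 powr (p - 1)))) powr (1 / p)) * vil_Hp_norm m p f"
    by (simp add: D_def)
qed

end


section \<open>Differences of Dirichlet kernels\<close>

context vilenkin
begin

text \<open>By \<open>kernel_M\<close>, this is the closed form of the Dirichlet kernel of order
  \<open>M (Suc k)\<close> minus that of order \<open>M k\<close>.\<close>

definition dirichlet_diff :: "nat \<Rightarrow> (nat \<Rightarrow> nat) \<Rightarrow> complex" where
  "dirichlet_diff k x = of_nat (M (Suc k)) * indicator (cyl (Suc k) (\<lambda>_. 0)) x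
    - of_nat (M k) * indicator (cyl k (\<lambda>_. 0)) x"

text \<open>These are the conditional expectations of \<open>dirichlet_diff k\<close>: it has mean
  zero on cylinders of rank at most \<open>k\<close> and is measurable from rank
  \<open>Suc k\<close> on.\<close>

definition dirichlet_martingale :: "nat \<Rightarrow> nat \<Rightarrow> (nat \<Rightarrow> nat) \<Rightarrow> complex" where
  "dirichlet_martingale k n = (if n \<le> k then (\<lambda>_. 0) else dirichlet_diff k)"

lemma cyl_in_filtration_le:
  assumes "x \<in> G" "k \<le> n"
  shows "cyl k x \<in> sets (vil_filtration m n)"
proof -
  have "cyl k x = \<Union> (cyl n ` cyl k x)"
  proof
    show "cyl k x \<subseteq> \<Union> (cyl n ` cyl k x)"
      by (auto simp: mem_cyl_iff)
    show "\<Union> (cyl n ` cyl k x) \<subseteq> cyl k x"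
      using assms(2) by (auto simp: mem_cyl_iff)
  qed
  also have "\<dots> \<in> sets (vil_filtration m n)"
  proof (rule sets.finite_Union)
    show "finite (cyl n ` cyl k x)"
      by (rule finite_subset[OF image_mono[OF cyl_subset_group] finite_cyls])
    show "cyl n ` cyl k x \<subseteq> sets (vil_filtration m n)"
      using cyl_subset_group cyl_in_filtration by blast
  qed
  finally show ?thesis .
qed

lemma integrable_cyl_mult:
  assumes "g \<in> borel_measurable \<mu>" "\<And>x. cmod (g x) \<le> 1"
  shows "integrable \<mu> (\<lambda>x. indicator (cyl k y) x * g x :: complex)"
proof (rule integrable_const_bound[of _ 1])
  show "AE x in \<mu>. cmod (indicator (cyl k y) x * g x) \<le> 1"
    using assms(2) by (intro AE_I2) (auto simp: indicator_def)
qed (use assms(1) in measurable)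

lemma integral_cyl:
  assumes "x \<in> G"
  shows "(\<integral>t. indicator (cyl k x) t \<partial>\<mu>) = (1 / of_nat (M k) :: complex)"
proof -
  have "indicator (cyl k x) t = complex_of_real (indicator (cyl k x) t)" for t
    by (simp add: indicator_def)
  then have "(\<integral>t. indicator (cyl k x) t \<partial>\<mu>)
      = complex_of_real (\<integral>t. indicator (cyl k x) t \<partial>\<mu>)"
    by (simp only: integral_complex_of_real)
  also have "(\<integral>t. indicator (cyl k x) t \<partial>\<mu>) = 1 / real (M k)"
    using cyl_subset_group[of k x]
    by (simp add: measure_cyl[OF assms] space_vil_measure Int_absorb2)
  finally show ?thesis by simp
qed

lemma integrable_cyl: "integrable \<mu> (\<lambda>x. indicator (cyl k y) x :: complex)"
  using integrable_cyl_mult[of "\<lambda>_. 1"] by simp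

lemma integral_dirichlet_diff: "(\<integral>x. dirichlet_diff k x \<partial>\<mu>) = 0"
  by (simp add: dirichlet_diff_def integrable_cyl integral_cyl)

lemma dirichlet_diff_eq_0: "x \<notin> cyl k (\<lambda>_. 0) \<Longrightarrow> dirichlet_diff k x = 0"
  using cyl_antimono[of k "Suc k" "\<lambda>_. 0"] by (auto simp: dirichlet_diff_def indicator_def)

text \<open>Only \<open>n \<le> k < l\<close> needs an argument: \<open>A\<close> either contains or
  misses \<open>cyl k (\<lambda>_. 0)\<close>, off which the difference vanishes, and its total
  integral is 0.\<close>

lemma martingale_dirichlet: "vil_martingale m (dirichlet_martingale k)"
  unfolding vil_martingale_def
proof (intro conjI allI impI ballI)
  fix n
  show "dirichlet_martingale k n \<in> borel_measurable (vil_filtration m n)"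
  proof (cases "n \<le> k")
    case False
    then have [measurable]: "cyl (Suc k) (\<lambda>_. 0) \<in> sets (vil_filtration m n)"
      "cyl k (\<lambda>_. 0) \<in> sets (vil_filtration m n)"
      by (auto intro: cyl_in_filtration_le)
    have "dirichlet_diff k \<in> borel_measurable (vil_filtration m n)"
      unfolding dirichlet_diff_def by measurable
    then show ?thesis
      using False by (simp add: dirichlet_martingale_def)
  qed (simp add: dirichlet_martingale_def)
  show "integrable \<mu> (dirichlet_martingale k n)"
    unfolding dirichlet_martingale_def dirichlet_diff_def by (simp add: integrable_cyl)
next
  fix n l A
  assume "n \<le> l" and A: "A \<in> sets (vil_filtration m n)"
  have "(LINT x:A|\<mu>. dirichlet_diff k x) = 0" if "n \<le> k"
  proof -
    have sub: "cyl k (\<lambda>_. 0) \<subseteq> cyl n (\<lambda>_. 0)"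
      using that by (rule cyl_antimono)
    have sat: "x \<in> A \<longleftrightarrow> (\<lambda>_. 0) \<in> A" if "x \<in> cyl k (\<lambda>_. 0)" for x
      using filtration_set_saturated[OF A zero_in_group, of x] that sub by auto
    show ?thesis
    proof (cases "(\<lambda>_. 0) \<in> A")
      case True
      then have "indicator A x *\<^sub>R dirichlet_diff k x = dirichlet_diff k x" for x
        using sat[of x] dirichlet_diff_eq_0[of x k] by (auto simp: indicator_def)
      then show ?thesis
        by (simp add: set_lebesgue_integral_def integral_dirichlet_diff)
    next
      case False
      then have "indicator A x *\<^sub>R dirichlet_diff k x = 0" for x
        using sat[of x] dirichlet_diff_eq_0[of x k] by (auto simp: indicator_def)
      then show ?thesis
        by (simp only: set_lebesgue_integral_def Bochner_Integration.integral_zero)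
    qed
  qed
  then show "(LINT x:A|\<mu>. dirichlet_martingale k l x) = (LINT x:A|\<mu>. dirichlet_martingale k n x)"
    using \<open>n \<le> l\<close> by (auto simp: dirichlet_martingale_def)
qed

section \<open>Fourier coefficients and norms of the test martingale\<close>

lemma rademacher_zero [simp]: "r k (\<lambda>_. 0) = 1"
  by (simp add: vil_rademacher_def)

lemma psi_zero [simp]: "\<psi> n (\<lambda>_. 0) = 1"
  by (simp add: vil_psi_def)

lemma integral_cyl_psi:
  assumes "i < M k"
  shows "(\<integral>x. indicator (cyl k (\<lambda>_. 0)) x * cnj (\<psi> i x) \<partial>\<mu>) = 1 / of_nat (M k)"
proof -
  have "indicator (cyl k (\<lambda>_. 0)) x * cnj (\<psi> i x) = indicator (cyl k (\<lambda>_. 0)) x" for x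
  proof (cases "x \<in> cyl k (\<lambda>_. 0)")
    case True
    then have "\<psi> i x = \<psi> i (\<lambda>_. 0)"
      by (intro psi_cong[OF assms]) (simp add: mem_cyl_iff)
    then show ?thesis by simp
  qed simp
  then show ?thesis
    by (simp only: integral_cyl[OF zero_in_group])
qed

lemma psi_M: "\<psi> (M k) = r k"
  using psi_power[of 1 k] two_le[of k] by (simp add: fun_eq_iff)

lemma rademacher_upd_power: "r k (x(k := d)) = r k (x(k := 1)) ^ d"
  by (simp add: vil_rademacher_def exp_of_nat_mult[symmetric] ac_simps)

text \<open>The cylinder splits by the value \<open>d\<close> of coordinate \<open>k\<close> into
  pieces of equal measure, and the values of \<open>r k\<close> on them are all powers of one root
  of unity.\<close>

lemma integral_cyl_rademacher:
  "(\<integral>x. indicator (cyl k (\<lambda>_. 0)) x * cnj (r k x) \<partial>\<mu>) = 0"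
proof -
  \<comment> \<open>\<open>z d\<close> represents the piece where coordinate \<open>k\<close> is
    \<open>d\<close>.\<close>
  define z :: "nat \<Rightarrow> nat \<Rightarrow> nat" where "z d = (\<lambda>_. 0)(k := d)" for d
  have z: "z d \<in> G" if "d < m k" for d
    using that by (simp add: z_def vil_group_def)
  have "1 < m k"
    using two_le[of k] by simp
  have eq: "indicator (cyl k (\<lambda>_. 0)) x * cnj (r k x)
      = (\<Sum>d<m k. cnj (r k (z d)) * indicator (cyl (Suc k) (z d)) x)" if "x \<in> G" for x
  proof (cases "x \<in> cyl k (\<lambda>_. 0)")
    case True
    have "x k < m k"
      using that by (simp add: vil_group_def)
    have "(\<Sum>d<m k. cnj (r k (z d)) * indicator (cyl (Suc k) (z d)) x)
        = (\<Sum>d\<in>{x k}. cnj (r k (z d)) * indicator (cyl (Suc k) (z d)) x)"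
      using \<open>x k < m k\<close> by (intro sum.mono_neutral_right) (auto simp: indicator_def mem_cyl_iff z_def)
    also have "\<dots> = cnj (r k x)"
      using True by (auto simp: mem_cyl_iff z_def less_Suc_eq vil_rademacher_def)
    finally show ?thesis
      using True by simp
  next
    case False
    then have "x \<notin> cyl (Suc k) (z d)" for d
      by (auto simp: mem_cyl_iff z_def less_Suc_eq)
    with False show ?thesis
      by simp
  qed
  have "(\<integral>x. indicator (cyl k (\<lambda>_. 0)) x * cnj (r k x) \<partial>\<mu>)
      = (\<integral>x. (\<Sum>d<m k. cnj (r k (z d)) * indicator (cyl (Suc k) (z d)) x) \<partial>\<mu>)"
    by (rule Bochner_Integration.integral_cong) (simp_all add: eq space_vil_measure)
  also have "\<dots> = (\<Sum>d<m k. cnj (r k (z d)) * (1 / of_nat (M (Suc k))))"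
    by (subst Bochner_Integration.integral_sum) (auto simp: integrable_cyl integral_cyl z)
  also have "\<dots> = cnj (\<Sum>d<m k. r k (z d)) / of_nat (M (Suc k))"
    by (simp add: sum_divide_distrib)
  also have "(\<Sum>d<m k. r k (z d)) = (\<Sum>d<m k. (r k (z 1) * cnj (r k (\<lambda>_. 0))) ^ d)"
    unfolding z_def rademacher_zero complex_cnj_one mult_1_right
    by (intro sum.cong refl rademacher_upd_power)
  also have "\<dots> = 0"
    by (rule sum_rademacher_eq_0) (use z[OF \<open>1 < m k\<close>] in \<open>auto simp: z_def\<close>)
  finally show ?thesis by simp
qed

text \<open>For \<open>i < M k\<close> both kernels contribute 1 and cancel; at
  \<open>i = M k\<close> the coarser one contributes 0.\<close>

lemma coeff_dirichlet:
  assumes "i \<le> M k"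
  shows "vil_coeff m (dirichlet_martingale k) i = (if i = M k then 1 else 0)"
proof -
  have [measurable]: "cnj \<in> borel_measurable borel"
    by (intro borel_measurable_continuous_onI continuous_intros)
  have "1 * M k < m k * M k"
    using two_le[of k] by (intro mult_strict_right_mono) auto
  then have i: "i < M (Suc k)"
    using assms by (simp only: M_Suc mult_1)
  have int: "integrable \<mu> (\<lambda>x. indicator (cyl j (\<lambda>_. 0)) x * cnj (\<psi> i x))" for j
    by (rule integrable_cyl_mult) auto
  have "vil_coeff m (dirichlet_martingale k) i = (\<integral>x. dirichlet_diff k x * cnj (\<psi> i x) \<partial>\<mu>)"
    unfolding vil_coeff_eq[OF martingale_dirichlet i] by (simp add: dirichlet_martingale_def)
  also have "\<dots> = (\<integral>x. of_nat (M (Suc k)) * (indicator (cyl (Suc k) (\<lambda>_. 0)) x * cnj (\<psi> i x))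
      - of_nat (M k) * (indicator (cyl k (\<lambda>_. 0)) x * cnj (\<psi> i x)) \<partial>\<mu>)"
    by (simp only: dirichlet_diff_def left_diff_distrib mult.assoc)
  also have "\<dots> = of_nat (M (Suc k)) * (\<integral>x. indicator (cyl (Suc k) (\<lambda>_. 0)) x * cnj (\<psi> i x) \<partial>\<mu>)
      - of_nat (M k) * (\<integral>x. indicator (cyl k (\<lambda>_. 0)) x * cnj (\<psi> i x) \<partial>\<mu>)"
    by (subst Bochner_Integration.integral_diff)
      (simp_all only: integrable_mult_right int integral_mult_right_zero)
  also have "\<dots> = 1 - of_nat (M k) * (\<integral>x. indicator (cyl k (\<lambda>_. 0)) x * cnj (\<psi> i x) \<partial>\<mu>)"
    by (simp add: integral_cyl_psi[OF i])
  also have "\<dots> = (if i = M k then 1 else 0)"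
    using assms by (simp add: integral_cyl_psi integral_cyl_rademacher psi_M)
  finally show ?thesis .
qed

lemma partial_sum_dirichlet:
  assumes "j \<le> Suc (M k)"
  shows "vil_partial_sum m (dirichlet_martingale k) j x = (if j = Suc (M k) then \<psi> (M k) x else 0)"
proof -
  have "vil_partial_sum m (dirichlet_martingale k) j x
      = (\<Sum>i<j. if i = M k then \<psi> (M k) x else 0)"
    unfolding vil_partial_sum_def using assms by (intro sum.cong) (auto simp: coeff_dirichlet)
  then show ?thesis
    using assms by auto
qed

text \<open>The sum runs over orders up to \<open>M k + 1\<close>; only the last partial sum is
  nonzero. It is unimodular and has weight 1.\<close>

lemma norm_log_mean_dirichlet:
  "cmod (vil_log_mean m (dirichlet_martingale k) (M k + 2) x) = 1 / harm (M k + 2)"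
  by (simp add: vil_log_mean_def partial_sum_dirichlet norm_divide norm_harm)

text \<open>The maximal function is at most \<open>M (Suc k)\<close> on a cylinder of measure
  \<open>1 / M k\<close> and vanishes outside it.\<close>

lemma Hp_norm_dirichlet_le:
  assumes "0 < p"
  shows "vil_Hp_norm m p (dirichlet_martingale k) \<le> ennreal (M (Suc k) * M k powr (- 1 / p))"
proof -
  have le: "maximal_fun (dirichlet_martingale k) x
      \<le> (if x \<in> cyl k (\<lambda>_. 0) then ennreal (M (Suc k)) else 0)" for x
    unfolding maximal_fun_def
  proof (rule SUP_least)
    fix n
    have "cmod (dirichlet_diff k x) \<le> M (Suc k)"
      using M_mono[of k "Suc k"] by (auto simp: dirichlet_diff_def indicator_def of_nat_diff[symmetric] simp del: of_nat_diff)
    then show "ennreal (cmod (dirichlet_martingale k n x))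
        \<le> (if x \<in> cyl k (\<lambda>_. 0) then ennreal (M (Suc k)) else 0)"
      by (auto simp: dirichlet_martingale_def dirichlet_diff_eq_0 intro: ennreal_leI)
  qed
  have "(\<integral>\<^sup>+ x. epowr (maximal_fun (dirichlet_martingale k) x) p \<partial>\<mu>)
      \<le> (\<integral>\<^sup>+ x. ennreal (M (Suc k) powr p) * indicator (cyl k (\<lambda>_. 0)) x \<partial>\<mu>)"
  proof (rule nn_integral_mono)
    fix x
    have "epowr (maximal_fun (dirichlet_martingale k) x) p
        \<le> epowr (if x \<in> cyl k (\<lambda>_. 0) then ennreal (M (Suc k)) else 0) p"
      using assms by (intro epowr_mono le) auto
    also have "\<dots> = ennreal (M (Suc k) powr p) * indicator (cyl k (\<lambda>_. 0)) x"
      using epowr_ennreal[of 0 p] by (auto simp: epowr_ennreal)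
    finally show "epowr (maximal_fun (dirichlet_martingale k) x) p \<le> \<dots>" .
  qed
  also have "\<dots> = ennreal (M (Suc k) powr p / M k)"
    by (simp add: nn_integral_cmult emeasure_cyl flip: ennreal_mult)
  finally have "vil_Hp_norm m p (dirichlet_martingale k) \<le> epowr (ennreal (M (Suc k) powr p / M k)) (1 / p)"
    unfolding vil_Hp_norm_def vil_Lp_norm_def using assms by (intro epowr_mono) auto
  also have "\<dots> = ennreal (M (Suc k) * M k powr (- 1 / p))"
    using assms by (simp add: epowr_ennreal powr_divide powr_powr powr_minus_divide)
  finally show ?thesis .
qed

text \<open>The single index \<open>n = M k + 2\<close>, with weight at \<open>n + 1\<close>, bounds
  the supremum below by a constant, whose quasi-norm over a probability space is itself.\<close>

lemma Lp_norm_dirichlet_ge: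
  assumes "0 < p" "0 < \<phi> (M k + 3)"
  shows "ennreal (1 / (harm (M k + 2) * \<phi> (M k + 3)))
    \<le> vil_Lp_norm m p (log_mean_maximal m \<phi> (dirichlet_martingale k))"
proof -
  define c where "c = 1 / (harm (M k + 2) * \<phi> (M k + 3))"
  have c: "0 \<le> c"
    using assms(2) by (simp add: c_def harm_nonneg)
  have three: "M k + 2 + 1 = M k + 3"
    by simp
  have "ennreal c \<le> log_mean_maximal m \<phi> (dirichlet_martingale k) x" for x
  proof -
    have "ennreal c = ennreal (cmod (vil_log_mean m (dirichlet_martingale k) (M k + 2) x) / \<phi> (M k + 2 + 1))"
      by (simp only: norm_log_mean_dirichlet c_def divide_divide_eq_left three)
    also have "\<dots> \<le> log_mean_maximal m \<phi> (dirichlet_martingale k) x"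
      unfolding log_mean_maximal_def by (rule SUP_upper) simp
    finally show ?thesis .
  qed
  then have "(\<integral>\<^sup>+ x. epowr (ennreal c) p \<partial>\<mu>)
      \<le> (\<integral>\<^sup>+ x. epowr (log_mean_maximal m \<phi> (dirichlet_martingale k) x) p \<partial>\<mu>)"
    using assms(1) by (intro nn_integral_mono epowr_mono) auto
  then have "epowr (epowr (ennreal c) p) (1 / p)
      \<le> vil_Lp_norm m p (log_mean_maximal m \<phi> (dirichlet_martingale k))"
    unfolding vil_Lp_norm_def using assms(1) by (intro epowr_mono) (auto simp: emeasure_space_1)
  then show ?thesis
    using c assms(1) by (simp add: epowr_ennreal powr_powr c_def)
qed

end

section \<open>Unboundedness for slowly growing weights\<close>

context bounded_vilenkin
begin

lemma unbounded_log_mean_maximal: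
  assumes p: "0 < p" "p < 1" and \<phi>: "\<forall>n\<ge>1. 1 \<le> \<phi> n" "mono_on {1..} \<phi>"
    and lim: "limsup (\<lambda>n. ereal (real n powr (1 / p - 1) / (ln (real n) * \<phi> n))) = \<infinity>"
  shows "\<not> bounded_Hp_Lp m p (log_mean_maximal m \<phi>)"
proof
  assume "bounded_Hp_Lp m p (log_mean_maximal m \<phi>)"
  then obtain c0 where c0: "\<And>f. f \<in> vil_Hp m p \<Longrightarrow>
      vil_Lp_norm m p (log_mean_maximal m \<phi> f) \<le> ennreal c0 * vil_Hp_norm m p f"
    unfolding bounded_Hp_Lp_def by blast
  \<comment> \<open>\<open>c0\<close> may be negative, in which case \<open>ennreal c0\<close> is
    0.\<close>
  define c where "c = max c0 0"
  have c: "0 \<le> c" "ennreal c0 \<le> ennreal c"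
    by (auto simp: c_def intro: ennreal_leI)
  have \<phi>_pos: "0 < \<phi> n" if "1 \<le> n" for n
    using \<phi>(1) that by (meson less_le_trans zero_less_one)
  \<comment> \<open>The assumed inequality is tested on \<open>dirichlet_martingale k\<close> and
    multiplied by \<open>M k powr (1 / p - 1)\<close>, after which the powers of \<open>M k\<close>
    on the right cancel.\<close>
  have key: "M k powr (1 / p - 1) \<le> c * B * (harm (M k + 2) * \<phi> (M k + 3))" for k
  proof -
    define b where "b = harm (M k + 2) * \<phi> (M k + 3)"
    have b: "0 < b"
      using \<phi>_pos by (simp add: b_def harm_pos)
    have "dirichlet_martingale k \<in> vil_Hp m p"
      using martingale_dirichlet Hp_norm_dirichlet_le[OF p(1), of k]
      by (auto simp: vil_Hp_def intro: le_less_trans)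
    then have "ennreal (1 / b) \<le> ennreal c0 * vil_Hp_norm m p (dirichlet_martingale k)"
      unfolding b_def using Lp_norm_dirichlet_ge[of p \<phi> k] \<phi>_pos p(1) c0 by (fastforce intro: order_trans)
    also have "\<dots> \<le> ennreal c * ennreal (M (Suc k) * M k powr (- 1 / p))"
      by (intro mult_mono c Hp_norm_dirichlet_le p) auto
    also have "\<dots> = ennreal (c * (M (Suc k) * M k powr (- 1 / p)))"
      using c by (simp add: ennreal_mult)
    finally have "1 / b \<le> c * (M (Suc k) * M k powr (- 1 / p))"
      using c by simp
    also have "\<dots> \<le> c * (real (B * M k) * M k powr (- 1 / p))"
      using c M_Suc_le[of k] by (intro mult_left_mono mult_right_mono) (auto simp del: of_nat_mult)
    finally have "1 \<le> c * (real (B * M k) * M k powr (- 1 / p)) * b"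
      using b by (simp add: divide_le_eq)
    then have "M k powr (1 / p - 1) * 1 \<le> M k powr (1 / p - 1) * (c * (real (B * M k) * M k powr (- 1 / p)) * b)"
      by (intro mult_left_mono) auto
    also have "\<dots> = c * B * b * (M k powr (1 / p - 1) * M k powr 1 * M k powr (- 1 / p))"
      by simp
    also have "M k powr (1 / p - 1) * M k powr 1 * M k powr (- 1 / p) = 1"
      unfolding powr_add[symmetric] by simp
    finally show ?thesis
      by (simp add: b_def)
  qed
  \<comment> \<open>\<open>B * B\<close> comes from \<open>n \<le> B * B * M k\<close> for the
    \<open>k\<close> chosen below, and 2 from \<open>harm_le_two_ln\<close>.\<close>
  define C where "C = real (B * B) powr (1 / p - 1) * (c * B * 2)"
  have "real n powr (1 / p - 1) / (ln (real n) * \<phi> n) \<le> C" if n: "M 3 \<le> n" for n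
  proof -
    \<comment> \<open>With \<open>k = l - 2\<close>, \<open>M (Suc k) \<le> n\<close> leaves room
      for the shift: \<open>M k + 3 \<le> 2 * M k \<le> n\<close>, as \<open>M k \<ge> 4\<close>.
      The assumption \<open>M 3 \<le> n\<close> ensures \<open>k \<ge> 2\<close>.\<close>
    define l where "l = (LEAST l. n < M l)"
    have l: "n < M l"
      unfolding l_def by (rule LeastI[of _ n]) (rule less_M)
    have "3 < l"
      using M_mono[of l 3] l n by (meson leD le_trans not_less)
    then obtain k where k: "l = Suc (Suc k)" "2 \<le> k"
      by (metis Suc_le_D Suc_less_eq le_simps(2) less_eq_Suc_le numeral_2_eq_2 numeral_3_eq_3)
    have lo: "M (Suc k) \<le> n"
      using not_less_Least[of "Suc k" "\<lambda>l. n < M l"] unfolding l_def[symmetric] k by simp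
    have "4 \<le> M k"
      using two_power_le_M[of 2] M_mono[OF k(2)] by simp
    moreover have "2 * M k \<le> M (Suc k)"
      unfolding M_Suc using two_le by (intro mult_right_mono) auto
    ultimately have nk: "M k + 3 \<le> n" "3 \<le> n"
      using lo by linarith+
    have "n \<le> B * (B * M k)"
      using l unfolding k by (meson M_Suc_le le_trans less_imp_le mult_le_mono2)
    then have "real n \<le> real (B * B) * real (M k)"
      by (metis mult.assoc of_nat_le_iff of_nat_mult)
    then have "real n powr (1 / p - 1) \<le> (real (B * B) * real (M k)) powr (1 / p - 1)"
      using p by (intro powr_mono2) auto
    also have "\<dots> = real (B * B) powr (1 / p - 1) * M k powr (1 / p - 1)"
      by (rule powr_mult)
    also have "\<dots> \<le> real (B * B) powr (1 / p - 1) * (c * B * (harm (M k + 2) * \<phi> (M k + 3)))"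
      by (intro mult_left_mono key) auto
    also have "\<dots> \<le> real (B * B) powr (1 / p - 1) * (c * B * (2 * ln (real n) * \<phi> n))"
    proof (intro mult_left_mono mult_mono)
      show "harm (M k + 2) \<le> 2 * ln (real n)"
        using harm_mono[of "M k + 2" n] harm_le_two_ln[OF nk(2)] nk by (auto intro: order_trans)
      show "\<phi> (M k + 3) \<le> \<phi> n"
        using nk by (intro mono_onD[OF \<phi>(2)]) auto
    qed (use c nk \<phi>_pos[of "M k + 3"] in auto)
    also have "\<dots> = C * (ln (real n) * \<phi> n)"
      by (simp add: C_def)
    finally show ?thesis
      using nk \<phi>_pos[of n] by (simp add: divide_le_eq)
  qed
  then have "\<forall>\<^sub>F n in sequentially. ereal (real n powr (1 / p - 1) / (ln (real n) * \<phi> n)) \<le> ereal C"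
    by (intro eventually_sequentiallyI[of "M 3"]) simp
  then have "limsup (\<lambda>n. ereal (real n powr (1 / p - 1) / (ln (real n) * \<phi> n))) \<le> ereal C"
    by (rule Limsup_bounded)
  with lim show False
    by simp
qed

end

theorem theorem1:
  fixes m :: "nat \<Rightarrow> nat"
  assumes "\<And>k. 2 \<le> m k" and "bdd_above (range m)"
  shows "(\<forall>p::real. 0 < p \<and> p < 1 \<longrightarrow>
            bounded_Hp_Lp m p (log_mean_maximal m (\<lambda>n. real n powr (1 / p - 1)))) \<and>
         (\<forall>(p::real) (\<phi>::nat \<Rightarrow> real).
            0 < p \<and> p < 1 \<and> (\<forall>n\<ge>1. 1 \<le> \<phi> n) \<and> mono_on {1..} \<phi> \<and>
            limsup (\<lambda>n. ereal (real n powr (1 / p - 1) / (ln (real n) * \<phi> n))) = \<infinity> \<longrightarrow>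
            \<not> bounded_Hp_Lp m p (log_mean_maximal m \<phi>))"
proof -
  obtain B where B: "\<And>k. m k \<le> B"
    using assms(2) by (auto simp: bdd_above_def)
  interpret bounded_vilenkin m B
    by unfold_locales (rule assms(1), rule B)
  show ?thesis
    using bounded_log_mean_maximal unbounded_log_mean_maximal by blast
qed

end
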